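(* Let $p_0,p_1,p_2\in R_{2,1}$ have no common zeros on $\mathbb{P}^1\times\mathbb{P}^1$, and let $\mathrm{Syz}(p)$ be the syzygy module on $p_0,p_1,p_2$. Then: (1) In the generic case, $\mathrm{Syz}(p)$ has Hilbert function $$H_{\mathrm{Syz}(p)}(m,n)=\begin{cases}3(m-3)(n-1)-(m-5)(n-2)& m\ge 5,\ n\ge 2\\ m-5& m\ge 6,\ n=1\\ 2(n-2)& m=3,\ n\ge 3\\ 3(n-1)+n-2& m=4,\ n\ge 2\\ 0&\text{otherwise.}\end{cases}$$ (2) In the non-generic case, $\mathrm{Syz}(p)$ has Hilbert function $$H_{\mathrm{Syz}(p)}(m,n)=\begin{cases}3(m-3)(n-1)-(m-5)(n-2)& m\ge 5,\ n\ge 2\\ m-5& m\ge 6,\ n=1\\ (m-1)(n-2)& m=2,3,\ n\ge 3\\ 3(n-1)+n-2& m=4,\ n\ge 2\\ 0&\text{otherwise.}\end{cases}$$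
   Context: $k$ is an algebraically closed field and $R=k[x,y,z,w]$ is bigraded with $x,y$ of degree $(1,0)$ and $z,w$ of degree $(0,1)$; $R_{m,n}$ is the graded piece of degree $(m,n)$ and $R(-a,-b)_{m,n}=R_{m-a,n-b}$. The variables $x,y$ (resp. $z,w$) are homogeneous coordinates on the first (resp. second) factor of $\mathbb{P}^1\times\mathbb{P}^1$. The syzygy module is the bigraded module $\mathrm{Syz}(p)=\ker\big(R(-2,-1)^3\xrightarrow{[p_0\ p_1\ p_2]}R\big)$; thus $\mathrm{Syz}(p)_{m,n}$ consists of the triples $(A_0,A_1,A_2)\in R_{m-2,n-1}^3$ with $A_0p_0+A_1p_1+A_2p_2=0$. The Hilbert function of a finitely generated bigraded $R$-module $M$ is $H_M(m,n)=\dim_k M_{m,n}$. Generic and non-generic cases: identify $\mathbb{P}(R_{2,1})$ with $\mathbb{P}^5$. Since $p_0,p_1,p_2$ have no common zeros on $\mathbb{P}^1\times\mathbb{P}^1$ they are linearly independent, so $W(p)=\mathbb{P}(\mathrm{Span}(p_0,p_1,p_2))$ is a plane in $\mathbb{P}^5$. Let $Y\subset\mathbb{P}^5$ be the image of the Segre embedding $\mathbb{P}(R_{2,0})\times\mathbb{P}(R_{0,1})\to\mathbb{P}(R_{2,1})$ given by multiplication of polynomials. The case is generic if $W(p)\cap Y$ is finite, and non-generic if $W(p)\cap Y$ is infinite. *)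

theory Defs
  imports "HOL-Library.Poly_Mapping" "HOL-Library.Product_Plus"
    "HOL-Computational_Algebra.Polynomial"
begin

datatype var = VX | VY | VZ | VW

text \<open>Elements of \<open>R = k[x,y,z,w]\<close> are finitely supported functions from exponent vectors
  to coefficients; multiplication is the convolution product of \<^theory>\<open>HOL-Library.Poly_Mapping\<close>.\<close>

type_synonym monomial = "var \<Rightarrow>\<^sub>0 nat"

type_synonym 'k mpoly4 = "monomial \<Rightarrow>\<^sub>0 'k"

definition scale4 :: "'k::field \<Rightarrow> 'k mpoly4 \<Rightarrow> 'k mpoly4" where
  "scale4 c f = Poly_Mapping.single 0 c * f"

global_interpretation R: vector_space scale4
  by unfold_locales
    (simp_all add: scale4_def distrib_left distrib_right single_add mult_single
      flip: mult.assoc)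

text \<open>The piece \<open>R\<^bsub>m,n\<^esub>\<close>, with integer degrees; it is zero if \<open>m < 0\<close> or \<open>n < 0\<close>.\<close>

definition R_piece :: "int \<Rightarrow> int \<Rightarrow> 'k::field mpoly4 set" where
  "R_piece m n = {f. \<forall>t \<in> Poly_Mapping.keys f.
     int (Poly_Mapping.lookup t VX + Poly_Mapping.lookup t VY) = m \<and>
     int (Poly_Mapping.lookup t VZ + Poly_Mapping.lookup t VW) = n}"

definition eval4 :: "'k::field mpoly4 \<Rightarrow> 'k \<Rightarrow> 'k \<Rightarrow> 'k \<Rightarrow> 'k \<Rightarrow> 'k" where
  "eval4 f a b c d = (\<Sum>t \<in> Poly_Mapping.keys f. Poly_Mapping.lookup f t *
     a ^ Poly_Mapping.lookup t VX * b ^ Poly_Mapping.lookup t VY *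
     c ^ Poly_Mapping.lookup t VZ * d ^ Poly_Mapping.lookup t VW)"

text \<open>A point of \<open>\<P>\<^sup>1 \<times> \<P>\<^sup>1\<close> is given by homogeneous coordinates \<open>(a : b), (c : d)\<close>; the
  definition is used for bihomogeneous polynomials only, where the choice of representatives
  is immaterial.\<close>

definition no_common_zeros :: "'k::field mpoly4 \<Rightarrow> 'k mpoly4 \<Rightarrow> 'k mpoly4 \<Rightarrow> bool" where
  "no_common_zeros p0 p1 p2 \<longleftrightarrow>
     \<not> (\<exists>a b c d. (a, b) \<noteq> (0, 0) \<and> (c, d) \<noteq> (0, 0) \<and>
        eval4 p0 a b c d = 0 \<and> eval4 p1 a b c d = 0 \<and> eval4 p2 a b c d = 0)"

text \<open>Points of a projective space \<open>\<P>(V)\<close> are the lines through the origin in \<open>V\<close>, so that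
  \<open>\<P>(R\<^bsub>2,1\<^esub>)\<close> itself plays the role of \<open>\<P>\<^sup>5\<close>.\<close>

definition projectivization :: "'k::field mpoly4 set \<Rightarrow> 'k mpoly4 set set" where
  "projectivization V = {R.span {v} | v. v \<in> V \<and> v \<noteq> 0}"

definition W_plane :: "'k::field mpoly4 \<Rightarrow> 'k mpoly4 \<Rightarrow> 'k mpoly4 \<Rightarrow> 'k mpoly4 set set" where
  "W_plane p0 p1 p2 = projectivization (R.span {p0, p1, p2})"

definition segre_Y :: "'k::field mpoly4 set set" where
  "segre_Y = {R.span {q * l} | q l. q \<in> R_piece 2 0 \<and> q \<noteq> 0 \<and> l \<in> R_piece 0 1 \<and> l \<noteq> 0}"

definition generic_case :: "'k::field mpoly4 \<Rightarrow> 'k mpoly4 \<Rightarrow> 'k mpoly4 \<Rightarrow> bool" where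
  "generic_case p0 p1 p2 \<longleftrightarrow> finite (W_plane p0 p1 p2 \<inter> segre_Y)"

definition nongeneric_case :: "'k::field mpoly4 \<Rightarrow> 'k mpoly4 \<Rightarrow> 'k mpoly4 \<Rightarrow> bool" where
  "nongeneric_case p0 p1 p2 \<longleftrightarrow> infinite (W_plane p0 p1 p2 \<inter> segre_Y)"

definition scale_triple ::
    "'k::field \<Rightarrow> 'k mpoly4 \<times> 'k mpoly4 \<times> 'k mpoly4 \<Rightarrow> 'k mpoly4 \<times> 'k mpoly4 \<times> 'k mpoly4" where
  "scale_triple c = map_prod (scale4 c) (map_prod (scale4 c) (scale4 c))"

global_interpretation R3: vector_space scale_triple
  by unfold_locales
    (auto simp: scale_triple_def R.scale_right_distrib R.scale_left_distrib)

text \<open>The piece of bidegree \<open>(m,n)\<close> of the free module \<open>R(-2,-1)\<^sup>3\<close>.\<close>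

definition free_piece :: "int \<Rightarrow> int \<Rightarrow> ('k::field mpoly4 \<times> 'k mpoly4 \<times> 'k mpoly4) set" where
  "free_piece m n =
     R_piece (m - 2) (n - 1) \<times> R_piece (m - 2) (n - 1) \<times> R_piece (m - 2) (n - 1)"

definition Syz :: "'k::field mpoly4 \<Rightarrow> 'k mpoly4 \<Rightarrow> 'k mpoly4 \<Rightarrow>
    ('k mpoly4 \<times> 'k mpoly4 \<times> 'k mpoly4) set" where
  "Syz p0 p1 p2 = {(A0, A1, A2). A0 * p0 + A1 * p1 + A2 * p2 = 0}"

text \<open>Hilbert function of a bigraded submodule \<open>M\<close> of \<open>R(-2,-1)\<^sup>3\<close>, whose piece of bidegree
  \<open>(m,n)\<close> is cut out by that of the ambient free module. All these pieces are
  finite-dimensional, so the convention \<open>dim = 0\<close> for infinite dimension plays no role.\<close>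

definition hilbert_function ::
    "('k::field mpoly4 \<times> 'k mpoly4 \<times> 'k mpoly4) set \<Rightarrow> int \<Rightarrow> int \<Rightarrow> nat" where
  "hilbert_function M m n = R3.dim (M \<inter> free_piece m n)"

end

theory Submission
  imports Defs
begin

text \<open>Write \<open>p\<^sub>i = z f\<^sub>i + w g\<^sub>i\<close> with binary quadratic forms in \<open>x, y\<close>. Since there are no common
  zeros, the vector of quartics \<open>h = f \<times> g\<close> has no zero on \<open>\<P>\<^sup>1\<close>. This forces the
  multiplication map from triples of bidegree \<open>(m-2,n-1)\<close> to \<open>R\<^bsub>m,n\<^esub>\<close> to be injective in bidegrees \<open>(5,1)\<close>
  and \<open>(3,2)\<close>, where source and target both have dimension 12. It is therefore surjective there,
  hence in all larger bidegrees, and rank--nullity gives the Hilbert function for \<open>m \<ge> 5\<close> or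
  \<open>m \<ge> 3, n \<ge> 2\<close>.

  For \<open>m = 2\<close> expand \<open>p\<close> in \<open>x\<^sup>2, xy, y\<^sup>2\<close>; its coefficients form a \<open>3 \<times> 3\<close> matrix of linear
  forms in \<open>z, w\<close> of rank at least 2 at every point. The syzygies of degree 0 in \<open>x, y\<close> form its kernel, which vanishes
  unless the determinant \<open>\<Delta>\<close> is zero. If \<open>\<Delta> = 0\<close>, the kernel is generated by a nonzero cross product of two columns,
  of degree exactly 2, because injectivity in bidegree \<open>(3,2)\<close> rules out lower degrees.
  Finally, points of \<open>W \<inter> Y\<close> correspond to zeros of \<open>\<Delta>\<close> on \<open>\<P>\<^sup>1\<close>, so the case is generic iff \<open>\<Delta> \<noteq> 0\<close>.\<close>

section \<open>Dimensions of kernels and images\<close>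

context vector_space_pair
begin

text \<open>Rank-nullity relative to a subspace \<open>V\<close>; the finite spanning set
  \<open>T\<close> replaces finite-dimensionality of the ambient space, since \<open>R\<close>
  itself is infinite-dimensional. A basis \<open>K\<close> of the kernel is extended to a basis
  \<open>B\<close> of \<open>V\<close>, and \<open>f\<close> maps \<open>B - K\<close> to a basis of
  the image.\<close>

lemma dim_kernel_plus_image:
  assumes lin: "Vector_Spaces.linear s1 s2 f" and V: "vs1.subspace V" and T: "finite T" "V \<subseteq> vs1.span T"
  shows "vs1.dim V = vs1.dim {x \<in> V. f x = 0} + vs2.dim (f ` V)"
proof -
  interpret Vector_Spaces.linear s1 s2 f by fact
  let ?N = "{x \<in> V. f x = 0}"
  obtain K where K: "K \<subseteq> ?N" "vs1.independent K" "?N \<subseteq> vs1.span K" "card K = vs1.dim ?N"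
    by (rule vs1.basis_exists)
  obtain B where B: "K \<subseteq> B" "B \<subseteq> V" "vs1.independent B" "V \<subseteq> vs1.span B"
    using vs1.maximal_independent_subset_extend[of K V] K by blast
  have finB: "finite B" using vs1.independent_span_bound[OF T(1) B(3)] B(2) T(2) by blast
  have indep: "vs1.independent (B - K)" using B(3) vs1.independent_mono by blast
  \<comment> \<open>A kernel element of the span of \<open>B - K\<close> also lies in the span of
    \<open>K\<close>, so all its coordinates with respect to \<open>B\<close> vanish.\<close>
  have inj: "inj_on f (vs1.span (B - K))"
  proof (rule inj_onI)
    fix x y assume xy: "x \<in> vs1.span (B - K)" "y \<in> vs1.span (B - K)" "f x = f y"
    have "x - y \<in> vs1.span (B - K)" using xy vs1.span_diff by blast
    moreover have "x - y \<in> ?N"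
      using xy(3) vs1.span_minimal[OF _ V, of "B - K"] B(2) calculation by (auto simp: diff)
    then have "x - y \<in> vs1.span K" using K(3) by blast
    ultimately have "vs1.representation B (x - y) b = 0" for b
      using vs1.representation_extend[OF B(3), of "x - y" K] vs1.representation_ne_zero[of K "x - y" b]
        vs1.representation_extend[OF B(3), of "x - y" "B - K"] vs1.representation_ne_zero[of "B - K" "x - y" b]
        B(1) by auto
    moreover have "x - y \<in> vs1.span B" using \<open>x - y \<in> ?N\<close> B(4) by blast
    ultimately have "x - y = 0"
      using vs1.sum_nonzero_representation_eq[OF B(3), of "x - y"] by simp
    then show "x = y" by simp
  qed
  have "f ` V \<subseteq> vs2.span (f ` (B - K))"
  proof -
    have "f ` V \<subseteq> vs2.span (f ` B)" using B(4) span_image[of B] by auto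
    also have "\<dots> \<subseteq> vs2.span (insert 0 (f ` (B - K)))"
      by (rule vs2.span_mono) (use K(1) in auto)
    finally show ?thesis by simp
  qed
  moreover have "vs2.independent (f ` (B - K))"
    using independent_injective_image[OF indep inj] .
  moreover have "card (f ` (B - K)) = card (B - K)"
    by (rule card_image) (use inj inj_on_subset vs1.span_superset in blast)
  ultimately have "vs2.dim (f ` V) = card (B - K)"
    using vs2.dim_unique[of "f ` (B - K)" "f ` V"] B(2) by blast
  moreover have "vs1.dim V = card B" using vs1.dim_unique B by blast
  moreover have "card B = card K + card (B - K)"
    using card_Diff_subset[of K B] finB B(1) card_mono[of B K] finite_subset by fastforce
  ultimately show ?thesis using K(4) by simp
qed

end

context vector_space
begin

lemma dim_zero_space: "dim {0} = 0"
  by (rule dim_unique[of "{}"]) (auto simp: independent_empty)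

text \<open>A basis of \<open>W\<close> extends to one of \<open>V\<close>, and the dimension bound
  leaves no room for new vectors.\<close>

lemma subspace_eq_of_dim:
  assumes W: "subspace W" and "W \<subseteq> V" and T: "finite T" "V \<subseteq> span T" and "dim V \<le> dim W"
  shows "W = V"
proof -
  obtain A where A: "A \<subseteq> W" "independent A" "W \<subseteq> span A" "card A = dim W"
    by (rule basis_exists)
  obtain B where B: "A \<subseteq> B" "B \<subseteq> V" "independent B" "V \<subseteq> span B"
    using maximal_independent_subset_extend[of A V] A assms(2) by blast
  have "finite B" using independent_span_bound[OF T(1) B(3)] B(2) T(2) by blast
  moreover have "card B = dim V" using dim_unique[OF B(2,4,3)] by simp
  ultimately have "A = B" using card_seteq[of B A] A(4) B(1) assms(5) by simp
  then have "V \<subseteq> W" using B(4) span_minimal[OF A(1) W] by simp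
  then show ?thesis using assms(2) by blast
qed

text \<open>Independence is stated for an indexed family, which makes \<open>e\<close> injective: a
  repeated vector would satisfy a relation with coefficients 1 and -1.\<close>

lemma dim_eq_card_family:
  assumes I: "finite I" and e: "\<And>i. i \<in> I \<Longrightarrow> e i \<in> V" and V: "V \<subseteq> span (e ` I)"
    and indep: "\<And>c. (\<Sum>i\<in>I. scale (c i) (e i)) = 0 \<Longrightarrow> \<forall>i\<in>I. c i = 0"
  shows "dim V = card I"
proof -
  have inj: "inj_on e I"
  proof (rule inj_onI, rule ccontr)
    fix i j assume ij: "i \<in> I" "j \<in> I" "e i = e j" "i \<noteq> j"
    define c where "c = (\<lambda>k. if k = i then 1 else if k = j then -1 else 0 :: 'a)"
    have "(\<Sum>k\<in>I. scale (c k) (e k)) = (\<Sum>k\<in>{i,j}. scale (c k) (e k))"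
      by (rule sum.mono_neutral_right) (use I ij in \<open>auto simp: c_def\<close>)
    also have "\<dots> = 0" using ij by (simp add: c_def)
    finally have "c i = 0" using indep[of c] ij(1) by blast
    then show False by (simp add: c_def)
  qed
  have "independent (e ` I)"
  proof (rule independent_if_scalars_zero)
    fix f x assume f: "(\<Sum>x\<in>e ` I. scale (f x) x) = 0" and x: "x \<in> e ` I"
    have "(\<Sum>i\<in>I. scale (f (e i)) (e i)) = 0" using f by (simp add: sum.reindex[OF inj])
    then show "f x = 0" using indep[of "f \<circ> e"] x by auto
  qed (use I in auto)
  then have "dim V = card (e ` I)" using dim_unique[of "e ` I" V] e V by blast
  then show ?thesis using card_image[OF inj] by simp
qed

end

section \<open>Evaluation of polynomials and the bigraded pieces\<close>

text \<open>Substitution into any commutative \<open>k\<close>-algebra, with \<open>\<phi>\<close>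
  embedding the scalars. Evaluation at points and both dehomogenisations are instances, so the
  homomorphism laws are proved only once.\<close>

definition ev ::
    "('k \<Rightarrow> 'r) \<Rightarrow> 'r \<Rightarrow> 'r \<Rightarrow> 'r \<Rightarrow> 'r \<Rightarrow> 'k::field mpoly4 \<Rightarrow> 'r::comm_ring_1" where
  "ev \<phi> x y z w f = (\<Sum>t \<in> Poly_Mapping.keys f. \<phi> (Poly_Mapping.lookup f t) *
     x ^ Poly_Mapping.lookup t VX * y ^ Poly_Mapping.lookup t VY *
     z ^ Poly_Mapping.lookup t VZ * w ^ Poly_Mapping.lookup t VW)"

lemma eval4_eq_ev: "eval4 f a b c d = ev (\<lambda>u. u) a b c d f"
  by (simp add: eval4_def ev_def)

lemma poly_mapping_eq_sum_single:
  assumes "finite S" "Poly_Mapping.keys f \<subseteq> S"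
  shows "f = (\<Sum>t\<in>S. Poly_Mapping.single t (Poly_Mapping.lookup f t))"
proof (rule poly_mapping_eqI)
  fix t
  have "(\<Sum>s\<in>S. Poly_Mapping.lookup (Poly_Mapping.single s (Poly_Mapping.lookup f s)) t) =
      (\<Sum>s\<in>S. if s = t then Poly_Mapping.lookup f t else 0)"
    by (rule sum.cong) (auto simp: lookup_single when_def)
  also have "\<dots> = Poly_Mapping.lookup f t"
    using assms by (auto simp: in_keys_iff)
  finally show "Poly_Mapping.lookup f t =
      Poly_Mapping.lookup (\<Sum>s\<in>S. Poly_Mapping.single s (Poly_Mapping.lookup f s)) t"
    by (simp add: lookup_sum)
qed

locale scalar_hom =
  fixes \<phi> :: "'k::field \<Rightarrow> 'r::comm_ring_1"
  assumes zero: "\<phi> 0 = 0" and one: "\<phi> 1 = 1"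
    and add: "\<phi> (a + b) = \<phi> a + \<phi> b" and mult: "\<phi> (a * b) = \<phi> a * \<phi> b"
begin

text \<open>Since \<open>\<phi> 0 = 0\<close>, different polynomials can be summed over a common
  index set.\<close>

lemma ev_superset:
  assumes "finite S" "Poly_Mapping.keys f \<subseteq> S"
  shows "ev \<phi> x y z w f = (\<Sum>t\<in>S. \<phi> (Poly_Mapping.lookup f t) *
     x ^ Poly_Mapping.lookup t VX * y ^ Poly_Mapping.lookup t VY *
     z ^ Poly_Mapping.lookup t VZ * w ^ Poly_Mapping.lookup t VW)"
  unfolding ev_def
  by (rule sum.mono_neutral_left) (use assms in \<open>auto simp: in_keys_iff zero\<close>)

lemma ev_add: "ev \<phi> x y z w (f + g) = ev \<phi> x y z w f + ev \<phi> x y z w g"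
proof -
  let ?S = "Poly_Mapping.keys f \<union> Poly_Mapping.keys g"
  have S: "finite ?S" by simp
  show ?thesis
    unfolding ev_superset[OF S keys_add] ev_superset[OF S Un_upper1] ev_superset[OF S Un_upper2]
    by (simp add: lookup_add add distrib_right sum.distrib)
qed

lemma ev_zero: "ev \<phi> x y z w 0 = 0"
  by (simp add: ev_def)

lemma ev_sum: "ev \<phi> x y z w (sum f I) = (\<Sum>i\<in>I. ev \<phi> x y z w (f i))"
  by (induction I rule: infinite_finite_induct) (simp_all add: ev_zero ev_add)

lemma ev_single: "ev \<phi> x y z w (Poly_Mapping.single t c) = \<phi> c *
    x ^ Poly_Mapping.lookup t VX * y ^ Poly_Mapping.lookup t VY *
    z ^ Poly_Mapping.lookup t VZ * w ^ Poly_Mapping.lookup t VW"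
  using ev_superset[of "{t}" "Poly_Mapping.single t c"] by simp

text \<open>Both sides are additive in \<open>f\<close> and in \<open>g\<close>, which reduces the
  claim to single monomials.\<close>

lemma ev_mult: "ev \<phi> x y z w (f * g) = ev \<phi> x y z w f * ev \<phi> x y z w g"
proof -
  let ?e = "ev \<phi> x y z w"
  let ?F = "\<lambda>t. Poly_Mapping.single t (Poly_Mapping.lookup f t)"
  let ?G = "\<lambda>t. Poly_Mapping.single t (Poly_Mapping.lookup g t)"
  have f: "f = sum ?F (Poly_Mapping.keys f)" and g: "g = sum ?G (Poly_Mapping.keys g)"
    by (rule poly_mapping_eq_sum_single; simp)+
  have single: "?e (?F s * ?G t) = ?e (?F s) * ?e (?G t)" for s t
    by (simp add: mult_single ev_single lookup_add power_add mult algebra_simps)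
  have "?e (sum ?F (Poly_Mapping.keys f) * sum ?G (Poly_Mapping.keys g)) =
      ?e (sum ?F (Poly_Mapping.keys f)) * ?e (sum ?G (Poly_Mapping.keys g))"
    by (simp add: sum_product ev_sum single)
  then show ?thesis using f g by simp
qed

end

text \<open>The monomial \<open>x\<^sup>i y\<^bsup>a-i\<^esup> z\<^sup>j w\<^bsup>b-j\<^esup>\<close>, meaningful for \<open>i \<le> a\<close> and \<open>j \<le> b\<close> only (truncated subtraction).\<close>

definition bimon :: "nat \<Rightarrow> nat \<Rightarrow> nat \<Rightarrow> nat \<Rightarrow> monomial" where
  "bimon a b i j = Poly_Mapping.single VX i + Poly_Mapping.single VY (a - i) +
     Poly_Mapping.single VZ j + Poly_Mapping.single VW (b - j)"

lemma lookup_bimon [simp]: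
  "Poly_Mapping.lookup (bimon a b i j) VX = i" "Poly_Mapping.lookup (bimon a b i j) VY = a - i"
  "Poly_Mapping.lookup (bimon a b i j) VZ = j" "Poly_Mapping.lookup (bimon a b i j) VW = b - j"
  by (simp_all add: bimon_def lookup_add lookup_single)

lemma bimon_eq_iff [simp]: "bimon a b i j = bimon a b i' j' \<longleftrightarrow> i = i' \<and> j = j'"
  using lookup_bimon by metis

definition bimons :: "nat \<Rightarrow> nat \<Rightarrow> monomial set" where
  "bimons a b = (\<lambda>(i, j). bimon a b i j) ` ({..a} \<times> {..b})"

lemma inj_bimon: "inj_on (\<lambda>(i, j). bimon a b i j) S"
  by (auto simp: inj_on_def)

lemma finite_bimons [simp]: "finite (bimons a b)"
  and card_bimons: "card (bimons a b) = (a + 1) * (b + 1)"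
  by (simp_all add: bimons_def card_image[OF inj_bimon])

lemma sum_bimons: "sum F (bimons a b) = (\<Sum>i\<le>a. \<Sum>j\<le>b. F (bimon a b i j))"
  unfolding bimons_def sum.reindex[OF inj_bimon] sum.cartesian_product
  by (simp add: case_prod_beta)

lemma bimons_iff:
  "t \<in> bimons a b \<longleftrightarrow>
     Poly_Mapping.lookup t VX + Poly_Mapping.lookup t VY = a \<and>
     Poly_Mapping.lookup t VZ + Poly_Mapping.lookup t VW = b" (is "_ \<longleftrightarrow> ?R")
proof
  assume ?R
  have "t = bimon a b (Poly_Mapping.lookup t VX) (Poly_Mapping.lookup t VZ)"
  proof (rule poly_mapping_eqI)
    fix v show "Poly_Mapping.lookup t v =
        Poly_Mapping.lookup (bimon a b (Poly_Mapping.lookup t VX) (Poly_Mapping.lookup t VZ)) v"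
      using \<open>?R\<close> by (cases v) auto
  qed
  then show "t \<in> bimons a b" using \<open>?R\<close> unfolding bimons_def
    by (metis (no_types, lifting) SigmaI atMost_iff case_prod_conv image_eqI le_add1)
qed (auto simp: bimons_def)

lemma R_piece_iff: "f \<in> R_piece (int a) (int b) \<longleftrightarrow> Poly_Mapping.keys f \<subseteq> bimons a b"
  unfolding R_piece_def by (auto simp: bimons_iff simp flip: of_nat_add)

lemma R_piece_negative:
  assumes "m < 0 \<or> n < 0"
  shows "R_piece m n = {0}"
proof -
  have "f = 0" if "f \<in> R_piece m n" for f :: "'a mpoly4"
  proof -
    have "Poly_Mapping.keys f = {}"
      using that assms unfolding R_piece_def by fastforce
    then show ?thesis by simp
  qed
  then show ?thesis by (auto simp: R_piece_def)
qed

lemma subspace_R_piece: "R.subspace (R_piece m n)"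
proof (rule R.subspaceI)
  show "x + y \<in> R_piece m n" if "x \<in> R_piece m n" "y \<in> R_piece m n" for x y
    using that keys_add[of x y] unfolding R_piece_def by blast
  show "scale4 c x \<in> R_piece m n" if "x \<in> R_piece m n" for c x
    using that keys_mult[of "Poly_Mapping.single 0 c" x] unfolding R_piece_def scale4_def
    by (auto simp: split: if_splits)
qed (simp add: R_piece_def)

lemma R_piece_mult:
  assumes "f \<in> R_piece m n" "g \<in> R_piece m' n'"
  shows "f * g \<in> R_piece (m + m') (n + n')"
  unfolding R_piece_def
proof (intro CollectI ballI)
  fix t assume "t \<in> Poly_Mapping.keys (f * g)"
  then obtain r s where "t = r + s" "r \<in> Poly_Mapping.keys f" "s \<in> Poly_Mapping.keys g"
    using keys_mult[of f g] by blast
  then show "int (Poly_Mapping.lookup t VX + Poly_Mapping.lookup t VY) = m + m' \<and>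
      int (Poly_Mapping.lookup t VZ + Poly_Mapping.lookup t VW) = n + n'"
    using assms unfolding R_piece_def by (fastforce simp: lookup_add)
qed

lemma single_bimon_in_R_piece: "t \<in> bimons a b \<Longrightarrow> Poly_Mapping.single t c \<in> R_piece (int a) (int b)"
  by (simp add: R_piece_iff)

lemma scale4_single: "scale4 c (Poly_Mapping.single t d) = Poly_Mapping.single t (c * d)"
  by (simp add: scale4_def mult_single)

lemma R_piece_span: "R_piece (int a) (int b) \<subseteq> R.span ((\<lambda>t. Poly_Mapping.single t 1) ` bimons a b)"
proof
  fix f :: "'a mpoly4" assume "f \<in> R_piece (int a) (int b)"
  then have "f = (\<Sum>t\<in>bimons a b. Poly_Mapping.single t (Poly_Mapping.lookup f t))"
    by (intro poly_mapping_eq_sum_single) (auto simp: R_piece_iff)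
  also have "\<dots> = (\<Sum>t\<in>bimons a b. scale4 (Poly_Mapping.lookup f t) (Poly_Mapping.single t 1))"
    by (simp add: scale4_single)
  also have "\<dots> \<in> R.span ((\<lambda>t. Poly_Mapping.single t 1) ` bimons a b)"
    by (intro R.span_sum R.span_scale R.span_base) simp
  finally show "f \<in> R.span ((\<lambda>t. Poly_Mapping.single t 1) ` bimons a b)" .
qed

lemma lookup_sum_scale_single:
  assumes "finite S" "t \<in> S"
  shows "Poly_Mapping.lookup (\<Sum>s\<in>S. scale4 (c s) (Poly_Mapping.single s 1)) t = c t"
proof -
  have "Poly_Mapping.lookup (\<Sum>s\<in>S. scale4 (c s) (Poly_Mapping.single s 1)) t =
      (\<Sum>s\<in>S. if s = t then c t else 0)"
    unfolding lookup_sum by (rule sum.cong) (auto simp: scale4_single lookup_single when_def)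
  then show ?thesis using assms by simp
qed

lemma dim_R_piece: "R.dim (R_piece (int a) (int b) :: 'k::field mpoly4 set) = (a + 1) * (b + 1)"
proof -
  have "R.dim (R_piece (int a) (int b) :: 'k mpoly4 set) = card (bimons a b)"
  proof (rule R.dim_eq_card_family[where e = "\<lambda>t. Poly_Mapping.single t 1"])
    fix c :: "monomial \<Rightarrow> 'k"
    assume "(\<Sum>t\<in>bimons a b. scale4 (c t) (Poly_Mapping.single t 1)) = 0"
    then show "\<forall>t\<in>bimons a b. c t = 0"
      using lookup_sum_scale_single[of "bimons a b" _ c] by simp
  qed (simp_all add: single_bimon_in_R_piece R_piece_span)
  then show ?thesis by (simp add: card_bimons)
qed

section \<open>Pieces of the free module and their monomial bases\<close>

definition triple_mon :: "nat \<times> monomial \<Rightarrow> 'k::field mpoly4 \<times> 'k mpoly4 \<times> 'k mpoly4" where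
  "triple_mon = (\<lambda>(k, t). (if k = 0 then Poly_Mapping.single t 1 else 0,
     if k = 1 then Poly_Mapping.single t 1 else 0, if k = 2 then Poly_Mapping.single t 1 else 0))"

lemma scale_triple_simp [simp]: "scale_triple c (f, g, h) = (scale4 c f, scale4 c g, scale4 c h)"
  by (simp add: scale_triple_def)

lemma sum_triple_mon:
  "(\<Sum>i\<in>{..<3} \<times> S. scale_triple (c i) (triple_mon i)) =
    (\<Sum>t\<in>S. scale4 (c (0, t)) (Poly_Mapping.single t 1),
     \<Sum>t\<in>S. scale4 (c (1, t)) (Poly_Mapping.single t 1),
     \<Sum>t\<in>S. scale4 (c (2, t)) (Poly_Mapping.single t 1))"
proof -
  have sum3: "(\<Sum>k<3. F k) = F 0 + F 1 + F 2" for F :: "nat \<Rightarrow> 'b::comm_monoid_add"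
    by (simp add: numeral_eq_Suc)
  have "(\<Sum>i\<in>{..<3} \<times> S. scale_triple (c i) (triple_mon i)) =
      (\<Sum>k<3. \<Sum>t\<in>S. scale_triple (c (k, t)) (triple_mon (k, t)))"
    by (simp add: sum.cartesian_product case_prod_beta)
  also have "\<dots> = (\<Sum>t\<in>S. (scale4 (c (0, t)) (Poly_Mapping.single t 1), 0, 0)) +
      (\<Sum>t\<in>S. (0, scale4 (c (1, t)) (Poly_Mapping.single t 1), 0)) +
      (\<Sum>t\<in>S. (0, 0, scale4 (c (2, t)) (Poly_Mapping.single t 1)))"
    by (simp add: sum3 triple_mon_def)
  finally show ?thesis by (simp add: sum_prod)
qed

text \<open>The shift by (2,1) in \<open>R(-2,-1)\<close> is absorbed in the bidegree, so that the
  components lie in the piece of bidegree \<open>(a,b)\<close> with natural numbers \<open>a\<close>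
  and \<open>b\<close>.\<close>

lemma free_piece_span:
  "free_piece (int a + 2) (int b + 1) \<subseteq> R3.span (triple_mon ` ({..<3} \<times> bimons a b))"
proof
  fix F :: "'a mpoly4 \<times> 'a mpoly4 \<times> 'a mpoly4"
  assume F: "F \<in> free_piece (int a + 2) (int b + 1)"
  obtain f0 f1 f2 where f: "F = (f0, f1, f2)" by (cases F)
  define c where "c = (\<lambda>(k::nat, t). Poly_Mapping.lookup (if k = 0 then f0 else if k = 1 then f1 else f2) t)"
  have eq: "f = (\<Sum>t\<in>bimons a b. scale4 (Poly_Mapping.lookup f t) (Poly_Mapping.single t 1))"
    if "f \<in> R_piece (int a) (int b)" for f :: "'a mpoly4"
    using poly_mapping_eq_sum_single[of "bimons a b" f] that by (simp add: R_piece_iff scale4_single)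
  have "F = (\<Sum>i\<in>{..<3} \<times> bimons a b. scale_triple (c i) (triple_mon i))"
    using F unfolding sum_triple_mon f c_def free_piece_def by (auto intro!: eq)
  also have "\<dots> \<in> R3.span (triple_mon ` ({..<3} \<times> bimons a b))"
    by (intro R3.span_sum R3.span_scale R3.span_base) simp
  finally show "F \<in> R3.span (triple_mon ` ({..<3} \<times> bimons a b))" .
qed

lemma dim_free_piece:
  "R3.dim (free_piece (int a + 2) (int b + 1) :: ('k::field mpoly4 \<times> 'k mpoly4 \<times> 'k mpoly4) set) =
    3 * ((a + 1) * (b + 1))"
proof -
  have "R3.dim (free_piece (int a + 2) (int b + 1) :: ('k mpoly4 \<times> 'k mpoly4 \<times> 'k mpoly4) set) =
      card ({..<3::nat} \<times> bimons a b)"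
  proof (rule R3.dim_eq_card_family[where e = triple_mon])
    fix c :: "nat \<times> monomial \<Rightarrow> 'k"
    assume "(\<Sum>i\<in>{..<3} \<times> bimons a b. scale_triple (c i) (triple_mon i)) = 0"
    then have z: "(\<Sum>t\<in>bimons a b. scale4 (c (0, t)) (Poly_Mapping.single t 1)) = 0"
        "(\<Sum>t\<in>bimons a b. scale4 (c (1, t)) (Poly_Mapping.single t 1)) = 0"
        "(\<Sum>t\<in>bimons a b. scale4 (c (2, t)) (Poly_Mapping.single t 1)) = 0"
      by (simp_all add: sum_triple_mon zero_prod_def)
    have "c (0, t) = 0" "c (1, t) = 0" "c (2, t) = 0" if "t \<in> bimons a b" for t
      using lookup_sum_scale_single[OF finite_bimons that] z lookup_zero by metis+
    then show "\<forall>i\<in>{..<3} \<times> bimons a b. c i = 0"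
      by (auto simp: numeral_eq_Suc less_Suc_eq)
  next
    fix i assume "i \<in> {..<3::nat} \<times> bimons a b"
    then show "triple_mon i \<in> (free_piece (int a + 2) (int b + 1) :: ('k mpoly4 \<times> 'k mpoly4 \<times> 'k mpoly4) set)"
      using single_bimon_in_R_piece R.subspace_0[OF subspace_R_piece]
      by (auto simp: triple_mon_def free_piece_def)
  qed (simp_all add: free_piece_span)
  then show ?thesis by (simp add: card_bimons card_cartesian_product)
qed

lemma subspace_free_piece: "R3.subspace (free_piece m n)"
  by (rule R3.subspaceI)
     (auto simp: free_piece_def zero_prod_def R.subspace_0[OF subspace_R_piece]
        R.subspace_add[OF subspace_R_piece] R.subspace_scale[OF subspace_R_piece])

section \<open>Syzygies over univariate polynomials\<close>

text \<open>The ideal \<open>I\<close> generated by the three polynomials is principal, generated by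
  a nonzero element of least degree. A root of the generator would be a common root, so over an
  algebraically closed field the generator is a constant.\<close>

lemma bezout3:
  fixes h0 h1 h2 :: "'k::alg_closed_field poly"
  assumes no_root: "\<And>x. \<not> (poly h0 x = 0 \<and> poly h1 x = 0 \<and> poly h2 x = 0)"
  obtains u0 u1 u2 where "u0 * h0 + u1 * h1 + u2 * h2 = 1"
proof -
  define I where "I = {f. \<exists>u0 u1 u2. f = u0 * h0 + u1 * h1 + u2 * h2}"
  have comb: "f - q * g \<in> I" if fg: "f \<in> I" "g \<in> I" for f g q
  proof -
    obtain u0 u1 u2 v0 v1 v2 where "f = u0 * h0 + u1 * h1 + u2 * h2"
      "g = v0 * h0 + v1 * h1 + v2 * h2"
      using fg unfolding I_def by blast
    then have "f - q * g = (u0 - q * v0) * h0 + (u1 - q * v1) * h1 + (u2 - q * v2) * h2"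
      by (simp add: algebra_simps)
    then show ?thesis unfolding I_def by blast
  qed
  have hI: "h0 \<in> I" "h1 \<in> I" "h2 \<in> I"
    unfolding I_def mem_Collect_eq
    by (rule exI[of _ 1], rule exI[of _ 0], rule exI[of _ 0], simp)
       (rule exI[of _ 0], rule exI[of _ 1], rule exI[of _ 0], simp,
        rule exI[of _ 0], rule exI[of _ 0], rule exI[of _ 1], simp)
  have "\<exists>f. f \<in> I \<and> f \<noteq> 0" using hI no_root[of 0] by (metis poly_0)
  then obtain g where g: "g \<in> I" "g \<noteq> 0" and min: "\<And>f. f \<in> I \<Longrightarrow> f \<noteq> 0 \<Longrightarrow> degree g \<le> degree f"
    using ex_has_least_nat[of "\<lambda>f. f \<in> I \<and> f \<noteq> 0" _ degree] by blast
  have dvd: "g dvd f" if "f \<in> I" for f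
  proof (rule ccontr)
    assume "\<not> g dvd f"
    then have "f mod g \<noteq> 0" by (simp add: mod_eq_0_iff_dvd)
    moreover have "f mod g \<in> I" using comb[OF that g(1), of "f div g"] by (simp add: minus_div_mult_eq_mod)
    ultimately show False using min[of "f mod g"] degree_mod_less'[of g f] g(2) by simp
  qed
  have "degree g = 0"
  proof (rule ccontr)
    assume "degree g \<noteq> 0"
    then obtain x where "poly g x = 0" using alg_closed_imp_poly_has_root by blast
    then have "poly f x = 0" if "f \<in> I" for f using dvd[OF that] by (metis dvdE mult_eq_0_iff poly_mult)
    then show False using no_root hI by blast
  qed
  then obtain c where c: "g = [:c:]" using degree_eq_zeroE by blast
  obtain u0 u1 u2 where u: "g = u0 * h0 + u1 * h1 + u2 * h2" using g(1) unfolding I_def by blast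
  have "c \<noteq> 0" using g c by simp
  then have "1 = [:inverse c:] * g" using c by (simp add: one_pCons)
  also have "\<dots> = ([:inverse c:] * u0) * h0 + ([:inverse c:] * u1) * h1 + ([:inverse c:] * u2) * h2"
    unfolding u by (simp only: distrib_left mult.assoc)
  finally show thesis using that by metis
qed

text \<open>Homogeneous triples of degree \<open>e\<close> in two variables are dehomogenised; the last conjunct
  excludes a common zero at infinity.\<close>

definition base_point_free :: "nat \<Rightarrow> 'k::comm_ring_1 poly \<Rightarrow> 'k poly \<Rightarrow> 'k poly \<Rightarrow> bool" where
  "base_point_free e h0 h1 h2 \<longleftrightarrow>
     degree h0 \<le> e \<and> degree h1 \<le> e \<and> degree h2 \<le> e \<and>
     (\<forall>x. \<not> (poly h0 x = 0 \<and> poly h1 x = 0 \<and> poly h2 x = 0)) \<and>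
     \<not> (coeff h0 e = 0 \<and> coeff h1 e = 0 \<and> coeff h2 e = 0)"

text \<open>The hypotheses say that the triples \<open>a\<close> and \<open>h\<close> are parallel.
  With a Bezout relation \<open>u \<cdot> h = 1\<close> the factor is the polynomial
  \<open>u \<cdot> a\<close>, not merely a rational function.\<close>

lemma base_point_free_multiple:
  fixes h0 h1 h2 :: "'k::alg_closed_field poly"
  assumes "base_point_free e h0 h1 h2"
    and "a0 * h1 = a1 * h0" "a0 * h2 = a2 * h0" "a1 * h2 = a2 * h1"
  obtains q where "a0 = q * h0" "a1 = q * h1" "a2 = q * h2"
proof -
  obtain u0 u1 u2 where u: "u0 * h0 + u1 * h1 + u2 * h2 = 1"
    using bezout3[of h0 h1 h2] assms(1) unfolding base_point_free_def by blast
  define q where "q = u0 * a0 + u1 * a1 + u2 * a2"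
  have "a0 = q * h0" "a1 = q * h1" "a2 = q * h2"
    unfolding q_def using assms(2-) u by algebra+
  then show thesis using that by blast
qed

text \<open>Having no common zero at infinity, some \<open>h\<close> has degree exactly
  \<open>e\<close>, and degrees add in products.\<close>

lemma base_point_free_degree:
  fixes h0 h1 h2 :: "'k::field poly"
  assumes "base_point_free e h0 h1 h2" "q \<noteq> 0"
    and "degree (q * h0) \<le> d" "degree (q * h1) \<le> d" "degree (q * h2) \<le> d"
  shows "degree q + e \<le> d"
proof -
  have *: "degree q + e \<le> d" if "degree h \<le> e" "coeff h e \<noteq> 0" "degree (q * h) \<le> d" for h
  proof -
    have "degree h = e" "h \<noteq> 0" using that le_degree[of h e] by auto
    then show ?thesis using that(3) degree_mult_eq[of q h] assms(2) by simp
  qed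
  show ?thesis using assms(1,3-) * unfolding base_point_free_def by blast
qed

text \<open>A Bezout relation for \<open>h\<close> shows that \<open>s\<close> divides
  \<open>v\<close>, say \<open>v = s * q\<close>. Cancelling \<open>s\<close> gives
  \<open>w = q * h\<close>, and the degree bound on \<open>w\<close> forces
  \<open>q = 0\<close>.\<close>

lemma base_point_free_cofactor_zero:
  fixes h0 h1 h2 :: "'k::alg_closed_field poly"
  assumes bpf: "base_point_free e h0 h1 h2" and "s \<noteq> 0"
    and eq: "h0 * v = s * w0" "h1 * v = s * w1" "h2 * v = s * w2"
    and deg: "degree w0 < e" "degree w1 < e" "degree w2 < e"
  shows "v = 0"
proof -
  obtain u0 u1 u2 where u: "u0 * h0 + u1 * h1 + u2 * h2 = 1"
    using bezout3[of h0 h1 h2] bpf unfolding base_point_free_def by blast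
  define q where "q = u0 * w0 + u1 * w1 + u2 * w2"
  have v: "v = s * q" unfolding q_def using eq u by algebra
  have w: "w0 = q * h0" "w1 = q * h1" "w2 = q * h2" using eq v \<open>s \<noteq> 0\<close> by (auto simp: mult_ac)
  have "q = 0"
  proof (rule ccontr)
    assume "q \<noteq> 0"
    \<comment> \<open>The truncated difference \<open>e - 1\<close> is harmless: \<open>deg\<close>
      implies \<open>e > 0\<close>.\<close>
    then have "degree q + e \<le> e - 1"
      by (rule base_point_free_degree[OF bpf]) (use w deg in auto)
    then show False using deg by simp
  qed
  then show ?thesis using v by simp
qed

text \<open>A vector orthogonal to \<open>f\<close> and \<open>g\<close> is parallel to
  \<open>f \<times> g\<close>, hence a polynomial multiple of it, and its degree is too small for a
  nonzero multiple.\<close>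

lemma cross_syzygy_zero:
  fixes f0 f1 f2 g0 g1 g2 :: "'k::alg_closed_field poly"
  assumes bpf: "base_point_free e (f1 * g2 - f2 * g1) (f2 * g0 - f0 * g2) (f0 * g1 - f1 * g0)"
    and af: "a0 * f0 + a1 * f1 + a2 * f2 = 0" and ag: "a0 * g0 + a1 * g1 + a2 * g2 = 0"
    and deg: "degree a0 < e" "degree a1 < e" "degree a2 < e"
  shows "a0 = 0 \<and> a1 = 0 \<and> a2 = 0"
proof -
  have "a0 * (f2 * g0 - f0 * g2) = a1 * (f1 * g2 - f2 * g1)"
    "a0 * (f0 * g1 - f1 * g0) = a2 * (f1 * g2 - f2 * g1)"
    "a1 * (f0 * g1 - f1 * g0) = a2 * (f2 * g0 - f0 * g2)"
    using af ag by algebra+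
  from base_point_free_multiple[OF bpf this] obtain q where
    q: "a0 = q * (f1 * g2 - f2 * g1)" "a1 = q * (f2 * g0 - f0 * g2)" "a2 = q * (f0 * g1 - f1 * g0)" .
  have "q = 0"
  proof (rule ccontr)
    assume "q \<noteq> 0"
    then have "degree q + e \<le> e - 1"
      by (rule base_point_free_degree[OF bpf]) (use q deg in auto)
    then show False using deg by simp
  qed
  then show ?thesis using q by simp
qed

text \<open>The three equations are the coefficients of \<open>z^2\<close>, 1 and \<open>z\<close>
  in \<open>(z c + e) \<cdot> (z f + g) = 0\<close>; this is the key to injectivity in bidegree
  (3,2).\<close>

lemma bilinear_syzygy_zero:
  fixes f0 f1 f2 g0 g1 g2 :: "'k::alg_closed_field poly"
  assumes bpf: "base_point_free 4 (f1 * g2 - f2 * g1) (f2 * g0 - f0 * g2) (f0 * g1 - f1 * g0)"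
    and degfg: "degree f0 \<le> 2" "degree f1 \<le> 2" "degree f2 \<le> 2"
      "degree g0 \<le> 2" "degree g1 \<le> 2" "degree g2 \<le> 2"
    and cf: "c0 * f0 + c1 * f1 + c2 * f2 = 0" and eg: "e0 * g0 + e1 * g1 + e2 * g2 = 0"
    and cg_ef: "c0 * g0 + c1 * g1 + c2 * g2 + (e0 * f0 + e1 * f1 + e2 * f2) = 0"
    and degce: "degree c0 \<le> 1" "degree c1 \<le> 1" "degree c2 \<le> 1"
      "degree e0 \<le> 1" "degree e1 \<le> 1" "degree e2 \<le> 1"
  shows "c0 = 0 \<and> c1 = 0 \<and> c2 = 0 \<and> e0 = 0 \<and> e1 = 0 \<and> e2 = 0"
proof -
  \<comment> \<open>Put \<open>s = c \<cdot> g = - e \<cdot> f\<close>, \<open>h = f \<times> g\<close> and \<open>v = c \<times> e\<close>. Then \<open>v \<cdot> h = s\<^sup>2\<close> and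
    \<open>h\<^sub>k v\<^sub>l = s (e\<^sub>k f\<^sub>l - c\<^sub>k g\<^sub>l + \<delta>\<^sub>k\<^sub>l s)\<close>, whose second factor has degree at most 3.\<close>
  define s where "s = c0 * g0 + c1 * g1 + c2 * g2"
  have deg: "degree (a * b) < 4" if "degree a \<le> 1" "degree b \<le> 2" for a b :: "'k poly"
    using degree_mult_le[of a b] that by simp
  have degW: "degree (a * b - c * d) < 4"
    if "degree a \<le> 1" "degree b \<le> 2" "degree c \<le> 1" "degree d \<le> 2" for a b c d :: "'k poly"
    using deg that degree_diff_less by blast
  have degs: "degree s < 4" unfolding s_def using deg degfg degce by (intro degree_add_less) auto
  have "s = 0"
  proof (rule ccontr)
    assume s: "s \<noteq> 0"
    define v0 v1 v2 where v: "v0 = c1 * e2 - c2 * e1" "v1 = c2 * e0 - c0 * e2" "v2 = c0 * e1 - c1 * e0"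
    have "v0 = 0"
      by (rule base_point_free_cofactor_zero[OF bpf s, of _ "e0 * f0 - c0 * g0 + s" "e1 * f0 - c1 * g0"
            "e2 * f0 - c2 * g0"])
         (unfold v s_def, use cf eg cg_ef in algebra, use cf eg cg_ef in algebra, use cf eg cg_ef in algebra,
          fold s_def, use degs degW degfg degce in \<open>auto intro!: degree_add_less\<close>)
    moreover have "v1 = 0"
      by (rule base_point_free_cofactor_zero[OF bpf s, of _ "e0 * f1 - c0 * g1" "e1 * f1 - c1 * g1 + s"
            "e2 * f1 - c2 * g1"])
         (unfold v s_def, use cf eg cg_ef in algebra, use cf eg cg_ef in algebra, use cf eg cg_ef in algebra,
          fold s_def, use degs degW degfg degce in \<open>auto intro!: degree_add_less\<close>)
    moreover have "v2 = 0"
      by (rule base_point_free_cofactor_zero[OF bpf s, of _ "e0 * f2 - c0 * g2" "e1 * f2 - c1 * g2"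
            "e2 * f2 - c2 * g2 + s"])
         (unfold v s_def, use cf eg cg_ef in algebra, use cf eg cg_ef in algebra, use cf eg cg_ef in algebra,
          fold s_def, use degs degW degfg degce in \<open>auto intro!: degree_add_less\<close>)
    \<comment> \<open>The Binet-Cauchy identity for
      \<open>(c \<times> e) \<cdot> (f \<times> g)\<close>, with
      \<open>c \<cdot> f = e \<cdot> g = 0\<close> and \<open>e \<cdot> f = - s\<close>.\<close>
    moreover have "s * s = v0 * (f1 * g2 - f2 * g1) + v1 * (f2 * g0 - f0 * g2) + v2 * (f0 * g1 - f1 * g0)"
      unfolding v s_def using cf eg cg_ef by algebra
    ultimately show False using s by simp
  qed
  then have "c0 * g0 + c1 * g1 + c2 * g2 = 0" "e0 * f0 + e1 * f1 + e2 * f2 = 0"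
    using cg_ef unfolding s_def by auto
  \<comment> \<open>Now \<open>c\<close> and \<open>e\<close> are each orthogonal to both
    \<open>f\<close> and \<open>g\<close>, and their degrees are below 4.\<close>
  then show ?thesis
    using cross_syzygy_zero[OF bpf cf] cross_syzygy_zero[OF bpf _ eg, of] degce by fastforce
qed

lemma binary_quadratic_root:
  fixes a b c :: "'k::alg_closed_field"
  obtains x y where "(x, y) \<noteq> (0, 0)" "a * x^2 + b * x * y + c * y^2 = 0"
proof (cases "a = 0")
  case True
  show thesis by (rule that[of 1 0]) (use True in auto)
next
  case False
  then have "degree [:c, b, a:] > 0" by simp
  then obtain x where "poly [:c, b, a:] x = 0" using alg_closed_imp_poly_has_root by blast
  then show thesis by (intro that[of x 1]) (auto simp: algebra_simps power2_eq_square)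
qed

text \<open>All 2 by 2 minors of the coefficient matrix vanish, so any root of a nonzero form among
  the three is a root of the others.\<close>

lemma proportional_quadratics_root:
  fixes a b c :: "'k::alg_closed_field"
  assumes "a0 * b1 = a1 * b0" "a0 * c1 = a1 * c0" "b0 * c1 = b1 * c0"
    and "a0 * b2 = a2 * b0" "a0 * c2 = a2 * c0" "b0 * c2 = b2 * c0"
    and "a1 * b2 = a2 * b1" "a1 * c2 = a2 * c1" "b1 * c2 = b2 * c1"
  obtains x y :: 'k where "(x, y) \<noteq> (0, 0)" "a0 * x^2 + b0 * x * y + c0 * y^2 = 0"
    "a1 * x^2 + b1 * x * y + c1 * y^2 = 0" "a2 * x^2 + b2 * x * y + c2 * y^2 = 0"
proof -
  \<comment> \<open>Multiplied by any coefficient of the first form, the second form becomes a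
    multiple of the first.\<close>
  have transfer_root: "a' * x^2 + b' * x * y + c' * y^2 = 0"
    if "(a, b, c) \<noteq> (0, 0, 0)" "a * x^2 + b * x * y + c * y^2 = 0"
      "a * b' = a' * b" "a * c' = a' * c" "b * c' = b' * c" for a b c a' b' c' x y :: 'k
  proof -
    have "a * (a' * x^2 + b' * x * y + c' * y^2) = 0" "b * (a' * x^2 + b' * x * y + c' * y^2) = 0"
      "c * (a' * x^2 + b' * x * y + c' * y^2) = 0"
      using that(2-) by algebra+
    then show ?thesis using that(1) by auto
  qed
  consider "(a0, b0, c0) \<noteq> (0, 0, 0)" | "(a1, b1, c1) \<noteq> (0, 0, 0)" | "(a2, b2, c2) \<noteq> (0, 0, 0)"
    | "a0 = 0 \<and> b0 = 0 \<and> c0 = 0 \<and> a1 = 0 \<and> b1 = 0 \<and> c1 = 0 \<and> a2 = 0 \<and> b2 = 0 \<and> c2 = 0"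
    by auto
  then show thesis
  proof cases
    case 1
    obtain x y where "(x, y) \<noteq> (0, 0)" "a0 * x^2 + b0 * x * y + c0 * y^2 = 0"
      by (rule binary_quadratic_root)
    then show thesis
      using transfer_root[OF 1, of x y b1 a1 c1] transfer_root[OF 1, of x y b2 a2 c2] assms
      by (intro that[of x y]) (simp_all add: mult.commute)
  next
    case 2
    obtain x y where "(x, y) \<noteq> (0, 0)" "a1 * x^2 + b1 * x * y + c1 * y^2 = 0"
      by (rule binary_quadratic_root)
    then show thesis
      using transfer_root[OF 2, of x y b0 a0 c0] transfer_root[OF 2, of x y b2 a2 c2] assms
      by (intro that[of x y]) (simp_all add: mult.commute)
  next
    case 3
    obtain x y where "(x, y) \<noteq> (0, 0)" "a2 * x^2 + b2 * x * y + c2 * y^2 = 0"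
      by (rule binary_quadratic_root)
    then show thesis
      using transfer_root[OF 3, of x y b0 a0 c0] transfer_root[OF 3, of x y b1 a1 c1] assms
      by (intro that[of x y]) (simp_all add: mult.commute)
  next
    case 4
    then show thesis by (intro that[of 1 0]) auto
  qed
qed

section \<open>Dehomogenisation\<close>

lemma poly_eq_pCons1: "degree p \<le> 0 \<Longrightarrow> p = [:coeff p 0:]"
  by (rule poly_eqI) (auto simp: coeff_pCons coeff_eq_0 split: nat.split)

lemma poly_eq_pCons2: "degree p \<le> 1 \<Longrightarrow> p = [:coeff p 0, coeff p 1:]"
  by (rule poly_eqI) (auto simp: coeff_pCons coeff_eq_0 split: nat.split)

lemma poly_eq_pCons3: "degree p \<le> 2 \<Longrightarrow> p = [:coeff p 0, coeff p 1, coeff p 2:]"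
  by (rule poly_eqI) (auto simp: coeff_pCons coeff_eq_0 numeral_2_eq_2 split: nat.split)

text \<open>The coefficient of \<open>x^i y^(a-i) z^j w^(b-j)\<close>; the bidegree
  \<open>(a,b)\<close> is needed to recover the exponents of \<open>y\<close> and
  \<open>w\<close>.\<close>

definition hcoeff :: "nat \<Rightarrow> nat \<Rightarrow> 'k::field mpoly4 \<Rightarrow> nat \<Rightarrow> nat \<Rightarrow> 'k" where
  "hcoeff a b f i j = Poly_Mapping.lookup f (bimon a b i j)"

lemma (in scalar_hom) ev_bihomogeneous:
  assumes "f \<in> R_piece (int a) (int b)"
  shows "ev \<phi> x y z w f =
    (\<Sum>i\<le>a. \<Sum>j\<le>b. \<phi> (hcoeff a b f i j) * x ^ i * y ^ (a - i) * z ^ j * w ^ (b - j))"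
  using assms by (simp add: ev_superset[of "bimons a b"] R_piece_iff sum_bimons hcoeff_def)

interpretation const2: scalar_hom "\<lambda>c::'k::field. [:[:c:]:]"
  by unfold_locales (simp_all add: one_pCons)

interpretation const1: scalar_hom "\<lambda>c::'k::field. [:c:]"
  by unfold_locales (simp_all add: one_pCons)

interpretation const0: scalar_hom "\<lambda>c::'k::field. c"
  by unfold_locales simp_all

text \<open>Setting \<open>y = w = 1\<close>: in \<open>dehom_xz\<close> the outer variable is \<open>z\<close> and the inner one \<open>x\<close>; in
  \<open>dehom_zx\<close> the roles are exchanged.\<close>

definition dehom_xz :: "'k::field mpoly4 \<Rightarrow> 'k poly poly" where
  "dehom_xz = ev (\<lambda>c. [:[:c:]:]) [:[:0, 1:]:] 1 [:0, 1:] 1"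

definition dehom_zx :: "'k::field mpoly4 \<Rightarrow> 'k poly poly" where
  "dehom_zx = ev (\<lambda>c. [:[:c:]:]) [:0, 1:] 1 [:[:0, 1:]:] 1"

lemmas dehom_xz_hom = const2.ev_add[of "[:[:0, 1:]:]" 1 "[:0, 1:]" 1, folded dehom_xz_def]
  const2.ev_mult[of "[:[:0, 1:]:]" 1 "[:0, 1:]" 1, folded dehom_xz_def]
  const2.ev_zero[of "[:[:0, 1:]:]" 1 "[:0, 1:]" 1, folded dehom_xz_def]

lemmas dehom_zx_hom = const2.ev_add[of "[:0, 1:]" 1 "[:[:0, 1:]:]" 1, folded dehom_zx_def]
  const2.ev_mult[of "[:0, 1:]" 1 "[:[:0, 1:]:]" 1, folded dehom_zx_def]
  const2.ev_zero[of "[:0, 1:]" 1 "[:[:0, 1:]:]" 1, folded dehom_zx_def]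

lemma const2_monom: "[:[:c:]:] * [:[:0, 1:]:] ^ i * [:0, 1:] ^ j = monom (monom (c::'k::field) i) j"
proof -
  have "[:[:0, 1::'k:]:] ^ i = [:monom 1 i:]"
    by (simp add: poly_const_pow monom_altdef)
  moreover have "[:0, 1::'k poly:] ^ j = monom 1 j"
    by (simp add: monom_altdef)
  ultimately show ?thesis by (simp add: smult_monom)
qed

lemma coeff_dehom_xz:
  assumes "f \<in> R_piece (int a) (int b)"
  shows "coeff (coeff (dehom_xz f) j) i = (if i \<le> a \<and> j \<le> b then hcoeff a b f i j else 0)"
proof -
  have "dehom_xz f = (\<Sum>i\<le>a. \<Sum>j\<le>b. monom (monom (hcoeff a b f i j) i) j)"
    unfolding dehom_xz_def const2.ev_bihomogeneous[OF assms] by (simp only: power_one mult_1_right const2_monom)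
  then have "coeff (coeff (dehom_xz f) j) i =
      (\<Sum>i'\<le>a. \<Sum>j'\<le>b. if j' = j then if i' = i then hcoeff a b f i j else 0 else 0)"
    by (auto simp: coeff_sum intro!: sum.cong)
  then show ?thesis by (cases "j \<le> b") simp_all
qed

lemma coeff_dehom_zx:
  assumes "f \<in> R_piece (int a) (int b)"
  shows "coeff (coeff (dehom_zx f) i) j = (if i \<le> a \<and> j \<le> b then hcoeff a b f i j else 0)"
proof -
  have "dehom_zx f = (\<Sum>i\<le>a. \<Sum>j\<le>b. monom (monom (hcoeff a b f i j) j) i)"
    unfolding dehom_zx_def const2.ev_bihomogeneous[OF assms]
    by (simp only: power_one mult_1_left mult_1_right const2_monom[symmetric] mult_ac)
  then have "coeff (coeff (dehom_zx f) i) j =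
      (\<Sum>i'\<le>a. \<Sum>j'\<le>b. if j' = j then if i' = i then hcoeff a b f i j else 0 else 0)"
    by (auto simp: coeff_sum intro!: sum.cong)
  then show ?thesis by (cases "j \<le> b") simp_all
qed

lemma R_piece_eqI:
  assumes "f \<in> R_piece (int a) (int b)" "g \<in> R_piece (int a) (int b)"
    and "\<And>i j. i \<le> a \<Longrightarrow> j \<le> b \<Longrightarrow> hcoeff a b f i j = hcoeff a b g i j"
  shows "f = g"
proof (rule poly_mapping_eqI)
  fix t
  show "Poly_Mapping.lookup f t = Poly_Mapping.lookup g t"
  proof (cases "t \<in> bimons a b")
    case True
    then show ?thesis using assms(3) unfolding bimons_def hcoeff_def by auto
  next
    case False
    then have "t \<notin> Poly_Mapping.keys f" "t \<notin> Poly_Mapping.keys g" using assms(1,2) by (auto simp: R_piece_iff)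
    then show ?thesis by (simp add: in_keys_iff)
  qed
qed

text \<open>Within a fixed bidegree the exponents of \<open>y\<close> and \<open>w\<close> are
  determined by those of \<open>x\<close> and \<open>z\<close>, so dehomogenisation loses
  nothing.\<close>

lemma dehom_xz_inject:
  assumes "f \<in> R_piece (int a) (int b)" "g \<in> R_piece (int a) (int b)" "dehom_xz f = dehom_xz g"
  shows "f = g"
  by (rule R_piece_eqI[OF assms(1,2)]) (use coeff_dehom_xz assms in metis)

lemma dehom_zx_inject:
  assumes "f \<in> R_piece (int a) (int b)" "g \<in> R_piece (int a) (int b)" "dehom_zx f = dehom_zx g"
  shows "f = g"
  by (rule R_piece_eqI[OF assms(1,2)]) (use coeff_dehom_zx assms in metis)

lemma zero_in_R_piece: "0 \<in> R_piece m n"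
  by (rule R.subspace_0[OF subspace_R_piece])

lemma dehom_xz_eq_0_iff: "f \<in> R_piece (int a) (int b) \<Longrightarrow> dehom_xz f = 0 \<longleftrightarrow> f = 0"
  using dehom_xz_inject[OF _ zero_in_R_piece] by (auto simp: dehom_xz_hom)

lemma dehom_zx_eq_0_iff: "f \<in> R_piece (int a) (int b) \<Longrightarrow> dehom_zx f = 0 \<longleftrightarrow> f = 0"
  using dehom_zx_inject[OF _ zero_in_R_piece] by (auto simp: dehom_zx_hom)

lemma degree_dehom_xz:
  assumes "f \<in> R_piece (int a) (int b)"
  shows "degree (dehom_xz f) \<le> b" "degree (coeff (dehom_xz f) j) \<le> a"
  by (auto intro!: degree_le poly_eqI simp: coeff_dehom_xz[OF assms])

lemma degree_dehom_zx:
  assumes "f \<in> R_piece (int a) (int b)"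
  shows "degree (dehom_zx f) \<le> a" "degree (coeff (dehom_zx f) j) \<le> b"
  by (auto intro!: degree_le poly_eqI simp: coeff_dehom_zx[OF assms])

text \<open>For \<open>p\<close> of bidegree (2,1), \<open>zcoeff p 1\<close> and
  \<open>zcoeff p 0\<close> are the quadratics \<open>f\<close> and \<open>g\<close> in
  \<open>p = z f + w g\<close>, taken at \<open>y = 1\<close>.\<close>

abbreviation zcoeff :: "'k::field mpoly4 \<Rightarrow> nat \<Rightarrow> 'k poly" where
  "zcoeff f j \<equiv> coeff (dehom_xz f) j"

text \<open>For \<open>p\<close> of bidegree (2,1) these are the linear forms in \<open>z, w\<close>
  multiplying \<open>x^i y^(2-i)\<close>, taken at \<open>w = 1\<close>.\<close>

abbreviation xcoeff :: "'k::field mpoly4 \<Rightarrow> nat \<Rightarrow> 'k poly" where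
  "xcoeff f i \<equiv> coeff (dehom_zx f) i"

lemma zcoeff_21:
  assumes "p \<in> R_piece 2 1"
  shows "zcoeff p 0 = [:hcoeff 2 1 p 0 0, hcoeff 2 1 p 1 0, hcoeff 2 1 p 2 0:]"
    "zcoeff p 1 = [:hcoeff 2 1 p 0 1, hcoeff 2 1 p 1 1, hcoeff 2 1 p 2 1:]"
    "dehom_xz p = [:zcoeff p 0, zcoeff p 1:]"
proof -
  have p: "p \<in> R_piece (int 2) (int 1)" using assms by simp
  show "zcoeff p 0 = [:hcoeff 2 1 p 0 0, hcoeff 2 1 p 1 0, hcoeff 2 1 p 2 0:]"
    "zcoeff p 1 = [:hcoeff 2 1 p 0 1, hcoeff 2 1 p 1 1, hcoeff 2 1 p 2 1:]"
    using poly_eq_pCons3[OF degree_dehom_xz(2)[OF p]] by (simp_all add: coeff_dehom_xz[OF p])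
  show "dehom_xz p = [:zcoeff p 0, zcoeff p 1:]"
    using poly_eq_pCons2 degree_dehom_xz(1)[OF p] by auto
qed

lemma xcoeff_21:
  assumes "p \<in> R_piece 2 1"
  shows "xcoeff p 0 = [:hcoeff 2 1 p 0 0, hcoeff 2 1 p 0 1:]"
    "xcoeff p 1 = [:hcoeff 2 1 p 1 0, hcoeff 2 1 p 1 1:]"
    "xcoeff p 2 = [:hcoeff 2 1 p 2 0, hcoeff 2 1 p 2 1:]"
    "dehom_zx p = [:xcoeff p 0, xcoeff p 1, xcoeff p 2:]"
proof -
  have p: "p \<in> R_piece (int 2) (int 1)" using assms by simp
  show "xcoeff p 0 = [:hcoeff 2 1 p 0 0, hcoeff 2 1 p 0 1:]"
    "xcoeff p 1 = [:hcoeff 2 1 p 1 0, hcoeff 2 1 p 1 1:]"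
    "xcoeff p 2 = [:hcoeff 2 1 p 2 0, hcoeff 2 1 p 2 1:]"
    using poly_eq_pCons2[OF degree_dehom_zx(2)[OF p]] by (simp_all add: coeff_dehom_zx[OF p])
  show "dehom_zx p = [:xcoeff p 0, xcoeff p 1, xcoeff p 2:]"
    using poly_eq_pCons3 degree_dehom_zx(1)[OF p] by auto
qed

lemma (in scalar_hom) ev_21:
  assumes "p \<in> R_piece 2 1"
  shows "ev \<phi> x y z w p =
    z * (\<phi> (hcoeff 2 1 p 2 1) * x ^ 2 + \<phi> (hcoeff 2 1 p 1 1) * x * y + \<phi> (hcoeff 2 1 p 0 1) * y ^ 2) +
    w * (\<phi> (hcoeff 2 1 p 2 0) * x ^ 2 + \<phi> (hcoeff 2 1 p 1 0) * x * y + \<phi> (hcoeff 2 1 p 0 0) * y ^ 2)"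
proof -
  have p: "p \<in> R_piece (int 2) (int 1)" using assms by simp
  have sum2: "(\<Sum>i\<le>2. F i) = F 0 + F 1 + F 2" and sum1: "(\<Sum>i\<le>1. F i) = F 0 + F 1"
    for F :: "nat \<Rightarrow> 'r"
    by (simp_all add: numeral_2_eq_2)
  show ?thesis
    unfolding ev_bihomogeneous[OF p] sum1 sum2 by (simp add: algebra_simps power2_eq_square)
qed

text \<open>Turns the vanishing of \<open>f \<times> g\<close> at a point of the first projective
  line into a point \<open>(c : d)\<close> of the second one.\<close>

lemma parallel_dependent:
  fixes f0 :: "'k::field"
  assumes "f1 * g2 = f2 * g1" "f2 * g0 = f0 * g2" "f0 * g1 = f1 * g0"
  obtains c d where "(c, d) \<noteq> (0, 0)" "c * f0 + d * g0 = 0" "c * f1 + d * g1 = 0" "c * f2 + d * g2 = 0"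
proof -
  consider "f0 \<noteq> 0" | "f1 \<noteq> 0" | "f2 \<noteq> 0" | "f0 = 0 \<and> f1 = 0 \<and> f2 = 0" by blast
  then show thesis
  proof cases
    case 1 then show thesis using assms by (intro that[of g0 "- f0"]) (auto simp: algebra_simps)
  next
    case 2 then show thesis using assms by (intro that[of g1 "- f1"]) (auto simp: algebra_simps)
  next
    case 3 then show thesis using assms by (intro that[of g2 "- f2"]) (auto simp: algebra_simps)
  next
    case 4 then show thesis by (intro that[of 1 0]) auto
  qed
qed

section \<open>Three forms of bidegree (2,1) without common zeros\<close>

locale three_forms =
  fixes p0 p1 p2 :: "'k::alg_closed_field mpoly4"
  assumes p0: "p0 \<in> R_piece 2 1" and p1: "p1 \<in> R_piece 2 1" and p2: "p2 \<in> R_piece 2 1"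
    and no_zeros: "no_common_zeros p0 p1 p2"
begin

lemma no_common_zero:
  assumes "(a, b) \<noteq> (0, 0)" "(c, d) \<noteq> (0, 0)"
  shows "\<not> (eval4 p0 a b c d = 0 \<and> eval4 p1 a b c d = 0 \<and> eval4 p2 a b c d = 0)"
  using no_zeros assms unfolding no_common_zeros_def by blast

text \<open>If \<open>f \<times> g\<close> vanishes at a point of the first factor, then
  \<open>c f + d g\<close> vanishes there for some \<open>(c : d)\<close>, which is a common zero of
  the three forms.\<close>

lemma cross_base_point_free:
  "base_point_free 4 (zcoeff p1 1 * zcoeff p2 0 - zcoeff p2 1 * zcoeff p1 0)
    (zcoeff p2 1 * zcoeff p0 0 - zcoeff p0 1 * zcoeff p2 0)
    (zcoeff p0 1 * zcoeff p1 0 - zcoeff p1 1 * zcoeff p0 0)"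
proof -
  have deg: "degree (a * b - c * d) \<le> 4"
    if "degree a \<le> 2" "degree b \<le> 2" "degree c \<le> 2" "degree d \<le> 2" for a b c d :: "'k poly"
    using degree_mult_le[of a b] degree_mult_le[of c d] that by (intro degree_diff_le) simp_all
  have degz: "degree (zcoeff p j) \<le> 2" if "p \<in> R_piece 2 1" for p :: "'k mpoly4" and j
    using degree_dehom_xz(2)[of p 2 1 j] that by simp
  \<comment> \<open>The degree 4 coefficients of \<open>f \<times> g\<close> are its values at the
    point \<open>(1 : 0)\<close>, which handles infinity.\<close>
  have coeff4: "coeff ([:a0, a1, a2:] * [:b0, b1, b2:]) 4 = a2 * b2" for a0 a1 a2 b0 b1 b2 :: 'k
    by (simp add: numeral_eq_Suc)
  show ?thesis
    unfolding base_point_free_def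
  proof (intro conjI notI allI)
    fix x
    assume *: "poly (zcoeff p1 1 * zcoeff p2 0 - zcoeff p2 1 * zcoeff p1 0) x = 0 \<and>
       poly (zcoeff p2 1 * zcoeff p0 0 - zcoeff p0 1 * zcoeff p2 0) x = 0 \<and>
       poly (zcoeff p0 1 * zcoeff p1 0 - zcoeff p1 1 * zcoeff p0 0) x = 0"
    obtain c d where "(c, d) \<noteq> (0, 0)" "c * poly (zcoeff p0 1) x + d * poly (zcoeff p0 0) x = 0"
        "c * poly (zcoeff p1 1) x + d * poly (zcoeff p1 0) x = 0"
        "c * poly (zcoeff p2 1) x + d * poly (zcoeff p2 0) x = 0"
      by (rule parallel_dependent[of "poly (zcoeff p1 1) x" "poly (zcoeff p2 0) x" "poly (zcoeff p2 1) x"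
            "poly (zcoeff p1 0) x" "poly (zcoeff p0 0) x" "poly (zcoeff p0 1) x"]) (use * in simp_all)
    moreover have "eval4 p x 1 c d = c * poly (zcoeff p 1) x + d * poly (zcoeff p 0) x"
      if "p \<in> R_piece 2 1" for p
      using that by (simp add: eval4_eq_ev const0.ev_21 zcoeff_21(1) zcoeff_21(2)[unfolded One_nat_def] algebra_simps power2_eq_square)
    ultimately show False using no_common_zero[of x 1 c d] p0 p1 p2 by auto
  next
    assume *: "coeff (zcoeff p1 1 * zcoeff p2 0 - zcoeff p2 1 * zcoeff p1 0) 4 = 0 \<and>
       coeff (zcoeff p2 1 * zcoeff p0 0 - zcoeff p0 1 * zcoeff p2 0) 4 = 0 \<and>
       coeff (zcoeff p0 1 * zcoeff p1 0 - zcoeff p1 1 * zcoeff p0 0) 4 = 0"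
    obtain c d where "(c, d) \<noteq> (0, 0)" "c * hcoeff 2 1 p0 2 1 + d * hcoeff 2 1 p0 2 0 = 0"
        "c * hcoeff 2 1 p1 2 1 + d * hcoeff 2 1 p1 2 0 = 0"
        "c * hcoeff 2 1 p2 2 1 + d * hcoeff 2 1 p2 2 0 = 0"
      by (rule parallel_dependent[of "hcoeff 2 1 p1 2 1" "hcoeff 2 1 p2 2 0" "hcoeff 2 1 p2 2 1"
            "hcoeff 2 1 p1 2 0" "hcoeff 2 1 p0 2 0" "hcoeff 2 1 p0 2 1"])
         (use * in \<open>simp_all only: coeff_diff zcoeff_21(1,2)[OF p0] zcoeff_21(1,2)[OF p1]
            zcoeff_21(1,2)[OF p2] coeff4 right_minus_eq\<close>)
    moreover have "eval4 p 1 0 c d = c * hcoeff 2 1 p 2 1 + d * hcoeff 2 1 p 2 0"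
      if "p \<in> R_piece 2 1" for p
      using that by (simp add: eval4_eq_ev const0.ev_21)
    ultimately show False using no_common_zero[of 1 0 c d] p0 p1 p2 by auto
  qed (use deg degz p0 p1 p2 in blast)+
qed

lemma dehom_xz_syzygy:
  assumes "A0 * p0 + A1 * p1 + A2 * p2 = 0"
  shows "dehom_xz A0 * [:zcoeff p0 0, zcoeff p0 1:] + dehom_xz A1 * [:zcoeff p1 0, zcoeff p1 1:] +
    dehom_xz A2 * [:zcoeff p2 0, zcoeff p2 1:] = 0"
  using arg_cong[OF assms, of dehom_xz]
  by (simp only: dehom_xz_hom zcoeff_21(3)[OF p0, symmetric] zcoeff_21(3)[OF p1, symmetric]
      zcoeff_21(3)[OF p2, symmetric])

text \<open>The triple does not involve \<open>z, w\<close>, so comparing coefficients of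
  \<open>z\<close> makes it orthogonal to both \<open>f\<close> and \<open>g\<close>; degree at most
  3 is too small for a multiple of the quartics \<open>f \<times> g\<close>.\<close>

lemma syzygy_x_zero:
  assumes A: "A0 \<in> R_piece (int a) 0" "A1 \<in> R_piece (int a) 0" "A2 \<in> R_piece (int a) 0" and a: "a \<le> 3"
    and syz: "A0 * p0 + A1 * p1 + A2 * p2 = 0"
  shows "A0 = 0 \<and> A1 = 0 \<and> A2 = 0"
proof -
  have A': "A0 \<in> R_piece (int a) (int 0)" "A1 \<in> R_piece (int a) (int 0)" "A2 \<in> R_piece (int a) (int 0)"
    using A by simp_all
  obtain a0 a1 a2 where a012: "dehom_xz A0 = [:a0:]" "dehom_xz A1 = [:a1:]" "dehom_xz A2 = [:a2:]"
    using degree_dehom_xz(1)[OF A'(1)] degree_dehom_xz(1)[OF A'(2)] degree_dehom_xz(1)[OF A'(3)]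
    by (metis poly_eq_pCons1)
  have deg: "degree a0 < 4" "degree a1 < 4" "degree a2 < 4"
    using degree_dehom_xz(2)[OF A'(1), of 0] degree_dehom_xz(2)[OF A'(2), of 0]
      degree_dehom_xz(2)[OF A'(3), of 0] a by (simp_all add: a012)
  have "a0 * zcoeff p0 1 + a1 * zcoeff p1 1 + a2 * zcoeff p2 1 = 0"
    "a0 * zcoeff p0 0 + a1 * zcoeff p1 0 + a2 * zcoeff p2 0 = 0"
    using dehom_xz_syzygy[OF syz] by (simp_all add: a012 algebra_simps)
  from cross_syzygy_zero[OF cross_base_point_free this deg] show ?thesis
    using dehom_xz_eq_0_iff[OF A'(1)] dehom_xz_eq_0_iff[OF A'(2)] dehom_xz_eq_0_iff[OF A'(3)]
    by (simp add: a012)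
qed

text \<open>Writing the triple as \<open>z c + w e\<close> and comparing coefficients of powers of
  \<open>z\<close> gives exactly the equations of \<open>bilinear_syzygy_zero\<close>.\<close>

lemma syzygy_11_zero:
  assumes A: "A0 \<in> R_piece 1 1" "A1 \<in> R_piece 1 1" "A2 \<in> R_piece 1 1"
    and syz: "A0 * p0 + A1 * p1 + A2 * p2 = 0"
  shows "A0 = 0 \<and> A1 = 0 \<and> A2 = 0"
proof -
  have A': "A0 \<in> R_piece (int 1) (int 1)" "A1 \<in> R_piece (int 1) (int 1)" "A2 \<in> R_piece (int 1) (int 1)"
    using A by simp_all
  obtain c0 c1 c2 e0 e1 e2 where
    ce: "dehom_xz A0 = [:e0, c0:]" "dehom_xz A1 = [:e1, c1:]" "dehom_xz A2 = [:e2, c2:]"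
    using degree_dehom_xz(1)[OF A'(1)] degree_dehom_xz(1)[OF A'(2)] degree_dehom_xz(1)[OF A'(3)]
    by (metis poly_eq_pCons2)
  have deg: "degree c0 \<le> 1" "degree c1 \<le> 1" "degree c2 \<le> 1" "degree e0 \<le> 1" "degree e1 \<le> 1" "degree e2 \<le> 1"
    using degree_dehom_xz(2)[OF A'(1), of 0] degree_dehom_xz(2)[OF A'(2), of 0]
      degree_dehom_xz(2)[OF A'(3), of 0] degree_dehom_xz(2)[OF A'(1), of 1] degree_dehom_xz(2)[OF A'(2), of 1]
      degree_dehom_xz(2)[OF A'(3), of 1] by (simp_all add: ce)
  have degz: "degree (zcoeff p j) \<le> 2" if "p \<in> R_piece 2 1" for p :: "'k mpoly4" and j
    using degree_dehom_xz(2)[of p 2 1 j] that by simp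
  note degfg = degz[OF p0] degz[OF p1] degz[OF p2] 
  have "c0 * zcoeff p0 1 + c1 * zcoeff p1 1 + c2 * zcoeff p2 1 = 0"
    "e0 * zcoeff p0 0 + e1 * zcoeff p1 0 + e2 * zcoeff p2 0 = 0"
    "c0 * zcoeff p0 0 + c1 * zcoeff p1 0 + c2 * zcoeff p2 0 +
      (e0 * zcoeff p0 1 + e1 * zcoeff p1 1 + e2 * zcoeff p2 1) = 0"
    using dehom_xz_syzygy[OF syz] by (simp_all add: ce algebra_simps)
  from bilinear_syzygy_zero[OF cross_base_point_free degfg(1-3) degfg(1-3) this deg] show ?thesis
    using dehom_xz_eq_0_iff[OF A'(1)] dehom_xz_eq_0_iff[OF A'(2)] dehom_xz_eq_0_iff[OF A'(3)]
    by (simp add: ce)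
qed

end

section \<open>The Hilbert function in the surjective range\<close>

interpretation RP: vector_space_pair scale_triple scale4
  by unfold_locales

lemma bimons_split:
  assumes "t \<in> bimons (c + a) (d + b)"
  obtains r s where "r \<in> bimons c d" "s \<in> bimons a b" "t = r + s"
proof -
  obtain i j where ij: "i \<le> c + a" "j \<le> d + b" "t = bimon (c + a) (d + b) i j"
    using assms unfolding bimons_def by auto
  \<comment> \<open>The factor \<open>s\<close> takes as much of \<open>x\<close> and
    \<open>z\<close> as its bidegree allows; \<open>r\<close> takes the rest.\<close>
  let ?r = "bimon c d (i - min i a) (j - min j b)" and ?s = "bimon a b (min i a) (min j b)"
  have "t = ?r + ?s"
  proof (rule poly_mapping_eqI)
    fix v show "Poly_Mapping.lookup t v = Poly_Mapping.lookup (?r + ?s) v"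
      using ij by (cases v) (auto simp: lookup_add min_def)
  qed
  moreover have "?r \<in> bimons c d" "?s \<in> bimons a b"
    using ij by (auto simp: bimons_iff min_def)
  ultimately show thesis by (rule that[rotated 2])
qed

context three_forms
begin

text \<open>The map \<open>[p0 p1 p2]\<close> whose kernel is the syzygy module.\<close>

definition comb :: "'k mpoly4 \<times> 'k mpoly4 \<times> 'k mpoly4 \<Rightarrow> 'k mpoly4" where
  "comb = (\<lambda>(A0, A1, A2). A0 * p0 + A1 * p1 + A2 * p2)"

lemma comb_simp: "comb (A0, A1, A2) = A0 * p0 + A1 * p1 + A2 * p2"
  by (simp add: comb_def)

lemma linear_comb: "Vector_Spaces.linear scale_triple scale4 comb"
  by unfold_locales (auto simp: comb_simp scale4_def algebra_simps)

lemma hilbert_function_eq: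
  "hilbert_function (Syz p0 p1 p2) m n = R3.dim {F \<in> free_piece m n. comb F = 0}"
proof -
  have "Syz p0 p1 p2 \<inter> free_piece m n = {F \<in> free_piece m n. comb F = 0}"
    by (auto simp: Syz_def comb_simp)
  then show ?thesis by (simp add: hilbert_function_def)
qed

lemma comb_image_subset: "comb ` free_piece m n \<subseteq> R_piece m n"
proof (clarify)
  fix A0 A1 A2 :: "'k mpoly4"
  assume "(A0, A1, A2) \<in> free_piece m n"
  then have "A * p \<in> R_piece m n" if "A \<in> {A0, A1, A2}" "p \<in> {p0, p1, p2}" for A p
    using R_piece_mult[of A "m - 2" "n - 1" p 2 1] that p0 p1 p2 by (auto simp: free_piece_def)
  then show "comb (A0, A1, A2) \<in> R_piece m n"
    unfolding comb_simp by (intro R.subspace_add[OF subspace_R_piece]) auto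
qed

lemma finite_triple_mon: "finite (triple_mon ` ({..<3} \<times> bimons a b))"
  by simp

lemma hilbert_function_plus_image:
  "hilbert_function (Syz p0 p1 p2) (int a + 2) (int b + 1) +
     R.dim (comb ` free_piece (int a + 2) (int b + 1)) = 3 * ((a + 1) * (b + 1))"
  using RP.dim_kernel_plus_image[OF linear_comb subspace_free_piece finite_triple_mon free_piece_span, of a b]
  by (simp add: hilbert_function_eq dim_free_piece)

lemma hilbert_function_zero:
  assumes "\<And>F. F \<in> free_piece m n \<Longrightarrow> comb F = 0 \<Longrightarrow> F = 0"
  shows "hilbert_function (Syz p0 p1 p2) m n = 0"
proof -
  have "{F \<in> free_piece m n. comb F = 0} = {0}"
    using assms R3.subspace_0[OF subspace_free_piece] by (auto simp: comb_simp zero_prod_def)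
  then show ?thesis by (simp add: hilbert_function_eq R3.dim_zero_space)
qed

lemma subspace_comb_image: "R.subspace (comb ` free_piece m n)"
  by (rule RP.linear_subspace_image[OF linear_comb subspace_free_piece])

text \<open>The hypothesis \<open>dim\<close> equates the dimensions of source and target, so an
  injective map is onto. It holds for \<open>(a,b) = (1,1)\<close> and \<open>(3,0)\<close>, where
  both sides are 12.\<close>

lemma comb_surj_of_inj:
  assumes inj: "\<And>F. F \<in> free_piece (int a + 2) (int b + 1) \<Longrightarrow> comb F = 0 \<Longrightarrow> F = 0"
    and dim: "3 * ((a + 1) * (b + 1)) = (a + 3) * (b + 2)"
  shows "comb ` free_piece (int a + 2) (int b + 1) = R_piece (int a + 2) (int b + 1)"
proof (rule R.subspace_eq_of_dim[OF subspace_comb_image comb_image_subset])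
  have *: "int a + 2 = int (a + 2)" "int b + 1 = int (b + 1)" by simp_all
  show "R_piece (int a + 2) (int b + 1) \<subseteq> R.span ((\<lambda>t. Poly_Mapping.single t 1) ` bimons (a + 2) (b + 1))"
    unfolding * by (rule R_piece_span)
  have "hilbert_function (Syz p0 p1 p2) (int a + 2) (int b + 1) = 0"
    by (rule hilbert_function_zero) (rule inj)
  then have "R.dim (comb ` free_piece (int a + 2) (int b + 1)) = (a + 3) * (b + 2)"
    using hilbert_function_plus_image[of a b] dim by linarith
  moreover have "R.dim (R_piece (int a + 2) (int b + 1) :: 'k mpoly4 set) = (a + 3) * (b + 2)"
    unfolding * dim_R_piece by (simp add: algebra_simps)
  ultimately show "R.dim (R_piece (int a + 2) (int b + 1) :: 'k mpoly4 set)
      \<le> R.dim (comb ` free_piece (int a + 2) (int b + 1))" by simp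
qed simp

text \<open>Every monomial of the larger bidegree is a multiple of one of the smaller bidegree, and
  \<open>comb\<close> commutes with multiplication by monomials.\<close>

lemma comb_surj_mono:
  assumes surj: "comb ` free_piece (int a + 2) (int b + 1) = R_piece (int a + 2) (int b + 1)"
  shows "comb ` free_piece (int (c + a) + 2) (int (d + b) + 1) = R_piece (int (c + a) + 2) (int (d + b) + 1)"
proof (rule equalityI[OF comb_image_subset])
  have *: "int (c + a) + 2 = int (c + (a + 2))" "int (d + b) + 1 = int (d + (b + 1))" by simp_all
  let ?I = "comb ` free_piece (int (c + a) + 2) (int (d + b) + 1)"
  have "Poly_Mapping.single t 1 \<in> ?I" if "t \<in> bimons (c + (a + 2)) (d + (b + 1))" for t
  proof -
    obtain r s where rs: "r \<in> bimons c d" "s \<in> bimons (a + 2) (b + 1)" "t = r + s"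
      using bimons_split[OF \<open>t \<in> bimons (c + (a + 2)) (d + (b + 1))\<close>] by blast
    have "Poly_Mapping.single s (1::'k) \<in> R_piece (int (a + 2)) (int (b + 1))"
      using rs(2) by (rule single_bimon_in_R_piece)
    then have "Poly_Mapping.single s (1::'k) \<in> comb ` free_piece (int a + 2) (int b + 1)"
      unfolding surj by (simp add: add.commute)
    then obtain A0 A1 A2 where A: "(A0, A1, A2) \<in> free_piece (int a + 2) (int b + 1)"
      "Poly_Mapping.single s 1 = comb (A0, A1, A2)" by auto
    let ?r = "Poly_Mapping.single r (1::'k)"
    have "?r * A \<in> R_piece (int (c + a)) (int (d + b))" if "A \<in> R_piece (int a) (int b)" for A
      using R_piece_mult[OF single_bimon_in_R_piece[OF rs(1), of "1::'k"] that] by simp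
    then have "(?r * A0, ?r * A1, ?r * A2) \<in> free_piece (int (c + a) + 2) (int (d + b) + 1)"
      using A(1) by (auto simp: free_piece_def)
    moreover have "comb (?r * A0, ?r * A1, ?r * A2) = ?r * comb (A0, A1, A2)"
      by (simp add: comb_simp algebra_simps)
    then have "comb (?r * A0, ?r * A1, ?r * A2) = Poly_Mapping.single t 1"
      by (simp add: A(2)[symmetric] mult_single rs(3))
    ultimately show ?thesis by (metis image_eqI)
  qed
  then have "R.span ((\<lambda>t. Poly_Mapping.single t 1) ` bimons (c + (a + 2)) (d + (b + 1))) \<subseteq> ?I"
    by (intro R.span_minimal subspace_comb_image) auto
  then show "R_piece (int (c + a) + 2) (int (d + b) + 1) \<subseteq> ?I"
    using R_piece_span[of "c + (a + 2)" "d + (b + 1)"] unfolding * by blast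
qed

lemma hilbert_function_of_surj:
  assumes "comb ` free_piece (int a + 2) (int b + 1) = R_piece (int a + 2) (int b + 1)"
  shows "int (hilbert_function (Syz p0 p1 p2) (int a + 2) (int b + 1)) =
    3 * ((int a + 1) * (int b + 1)) - (int a + 3) * (int b + 2)"
proof -
  have *: "int a + 2 = int (a + 2)" "int b + 1 = int (b + 1)" by simp_all
  have "R.dim (comb ` free_piece (int a + 2) (int b + 1)) = (a + 3) * (b + 2)"
    unfolding assms unfolding * dim_R_piece by (simp add: algebra_simps)
  then have "hilbert_function (Syz p0 p1 p2) (int a + 2) (int b + 1) + (a + 3) * (b + 2) = 3 * ((a + 1) * (b + 1))"
    using hilbert_function_plus_image[of a b] by linarith
  from arg_cong[OF this, of int] show ?thesis by (simp add: algebra_simps)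
qed

lemma comb_inj_x:
  assumes "a \<le> 3" "F \<in> free_piece (int a + 2) (int 0 + 1)" "comb F = 0"
  shows "F = 0"
  using assms syzygy_x_zero[of "fst F" a "fst (snd F)" "snd (snd F)"]
  by (cases F) (auto simp: free_piece_def comb_simp zero_prod_def)

lemma comb_inj_11:
  assumes "F \<in> free_piece (int 1 + 2) (int 1 + 1)" "comb F = 0"
  shows "F = 0"
  using assms syzygy_11_zero[of "fst F" "fst (snd F)" "snd (snd F)"]
  by (cases F) (auto simp: free_piece_def comb_simp zero_prod_def)

lemma hilbert_function_surj_range:
  assumes "a \<ge> 1 \<and> b \<ge> 1 \<or> a \<ge> 3"
  shows "int (hilbert_function (Syz p0 p1 p2) (int a + 2) (int b + 1)) =
    3 * ((int a + 1) * (int b + 1)) - (int a + 3) * (int b + 2)"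
proof (rule hilbert_function_of_surj)
  \<comment> \<open>The two minimal bidegrees (3,2) and (5,1), from which surjectivity spreads to
    all larger ones.\<close>
  have 11: "comb ` free_piece (int 1 + 2) (int 1 + 1) = R_piece (int 1 + 2) (int 1 + 1)"
    by (rule comb_surj_of_inj) (auto intro: comb_inj_11)
  have 30: "comb ` free_piece (int 3 + 2) (int 0 + 1) = R_piece (int 3 + 2) (int 0 + 1)"
    by (rule comb_surj_of_inj) (auto intro: comb_inj_x[of 3])
  show "comb ` free_piece (int a + 2) (int b + 1) = R_piece (int a + 2) (int b + 1)"
    using assms
  proof
    assume "a \<ge> 1 \<and> b \<ge> 1"
    then show ?thesis using comb_surj_mono[OF 11, of "a - 1" "b - 1"] by (simp only: le_add_diff_inverse2)
  next
    assume "a \<ge> 3"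
    then show ?thesis using comb_surj_mono[OF 30, of "a - 3" b] by (simp only: le_add_diff_inverse2 add_0_right)
  qed
qed

lemma hilbert_function_x_zero:
  assumes "a \<le> 3"
  shows "hilbert_function (Syz p0 p1 p2) (int a + 2) 1 = 0"
  using hilbert_function_zero[of "int a + 2" "int 0 + 1"] comb_inj_x[OF assms] by simp

lemma hilbert_function_negative:
  assumes "m < 2 \<or> n < 1"
  shows "hilbert_function (Syz p0 p1 p2) m n = 0"
proof (rule hilbert_function_zero)
  fix F assume "F \<in> free_piece m n"
  then show "F = 0" using R_piece_negative[of "m - 2" "n - 1"] assms
    by (auto simp: free_piece_def zero_prod_def)
qed

end

section \<open>Syzygies of degree zero in the first factor\<close>

fun dot3 :: "'a::comm_ring_1 \<times> 'a \<times> 'a \<Rightarrow> 'a \<times> 'a \<times> 'a \<Rightarrow> 'a" where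
  "dot3 (a0, a1, a2) (b0, b1, b2) = a0 * b0 + a1 * b1 + a2 * b2"

fun cross3 :: "'a::comm_ring_1 \<times> 'a \<times> 'a \<Rightarrow> 'a \<times> 'a \<times> 'a \<Rightarrow> 'a \<times> 'a \<times> 'a" where
  "cross3 (a0, a1, a2) (b0, b1, b2) = (a1 * b2 - a2 * b1, a2 * b0 - a0 * b2, a0 * b1 - a1 * b0)"

definition det3 :: "'a::comm_ring_1 \<times> 'a \<times> 'a \<Rightarrow> 'a \<times> 'a \<times> 'a \<Rightarrow> 'a \<times> 'a \<times> 'a \<Rightarrow> 'a" where
  "det3 u v w = dot3 (cross3 u v) w"

text \<open>By Cramer's rule each component of \<open>A\<close> times the determinant is zero, and
  some component is nonzero.\<close>

lemma det3_eq_0: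
  fixes A u v w :: "'a::idom \<times> 'a \<times> 'a"
  assumes "A \<noteq> 0" "dot3 A u = 0" "dot3 A v = 0" "dot3 A w = 0"
  shows "det3 u v w = 0"
proof -
  obtain A0 A1 A2 u0 u1 u2 v0 v1 v2 w0 w1 w2 where
    [simp]: "A = (A0, A1, A2)" "u = (u0, u1, u2)" "v = (v0, v1, v2)" "w = (w0, w1, w2)"
    by (metis prod_cases3)
  have eqs: "A0 * u0 + A1 * u1 + A2 * u2 = 0" "A0 * v0 + A1 * v1 + A2 * v2 = 0"
    "A0 * w0 + A1 * w1 + A2 * w2 = 0" using assms by simp_all
  have "A0 * det3 u v w = 0" "A1 * det3 u v w = 0" "A2 * det3 u v w = 0"
    unfolding det3_def using eqs by (simp_all, algebra+)
  then show ?thesis using assms(1) by (auto simp: zero_prod_def)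
qed

lemma dot3_cross3:
  "dot3 (cross3 u v) u = 0" "dot3 (cross3 u v) v = 0"
  "dot3 (cross3 u v) w = det3 u v w" "dot3 (cross3 v w) u = det3 u v w" "dot3 (cross3 u w) v = - det3 u v w"
  for u v w :: "'a::comm_ring_1 \<times> 'a \<times> 'a"
  by (cases u; cases v; cases w; simp add: det3_def algebra_simps)+

text \<open>The triple product expansion: \<open>A \<times> (u \<times> v) = u (A \<cdot> v) - v (A
  \<cdot> u)\<close>.\<close>

lemma cross3_cross3_eq_0:
  fixes A u v :: "'a::idom \<times> 'a \<times> 'a"
  assumes "dot3 A u = 0" "dot3 A v = 0"
  shows "cross3 A (cross3 u v) = 0"
proof -
  obtain A0 A1 A2 u0 u1 u2 v0 v1 v2 where
    [simp]: "A = (A0, A1, A2)" "u = (u0, u1, u2)" "v = (v0, v1, v2)"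
    by (metis prod_cases3)
  have eqs: "A0 * u0 + A1 * u1 + A2 * u2 = 0" "A0 * v0 + A1 * v1 + A2 * v2 = 0" using assms by simp_all
  show ?thesis using eqs by (simp add: zero_prod_def, algebra)
qed

text \<open>At rank 2 any nonzero cross product of two of the vectors spans the common orthogonal
  complement over the fraction field. Recording that \<open>H\<close> is such a cross product later
  bounds its degree.\<close>

lemma det3_eq_0_solution:
  fixes u v w :: "'a::idom \<times> 'a \<times> 'a"
  assumes det: "det3 u v w = 0" and rank: "cross3 u v \<noteq> 0 \<or> cross3 u w \<noteq> 0 \<or> cross3 v w \<noteq> 0"
  obtains H where "H \<noteq> 0" "H \<in> {cross3 u v, cross3 u w, cross3 v w}"
    "dot3 H u = 0" "dot3 H v = 0" "dot3 H w = 0"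
    "\<And>A. dot3 A u = 0 \<Longrightarrow> dot3 A v = 0 \<Longrightarrow> dot3 A w = 0 \<Longrightarrow> cross3 A H = 0"
proof -
  consider "cross3 u v \<noteq> 0" | "cross3 u w \<noteq> 0" | "cross3 v w \<noteq> 0" using rank by blast
  then show thesis
  proof cases
    case 1 then show thesis
      by (intro that[of "cross3 u v"] cross3_cross3_eq_0) (simp_all add: dot3_cross3(1-3) det)
  next
    case 2 then show thesis
      by (intro that[of "cross3 u w"] cross3_cross3_eq_0) (simp_all add: dot3_cross3(1,2,5) det)
  next
    case 3 then show thesis
      by (intro that[of "cross3 v w"] cross3_cross3_eq_0) (simp_all add: dot3_cross3(1,2,4) det)
  qed
qed

text \<open>Inverse to dehomogenisation in bidegree \<open>(0,b)\<close>; coefficients of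
  \<open>q\<close> beyond \<open>b\<close> are dropped, whence the degree condition in
  \<open>dehom_zx_homog_z\<close>.\<close>

definition homog_z :: "nat \<Rightarrow> 'k::field poly \<Rightarrow> 'k mpoly4" where
  "homog_z b q = (\<Sum>j\<le>b. Poly_Mapping.single (bimon 0 b 0 j) (coeff q j))"

lemma R_piece_sum: "(\<And>i. i \<in> I \<Longrightarrow> F i \<in> R_piece m n) \<Longrightarrow> sum F I \<in> R_piece m n"
  by (rule R.subspace_sum[OF subspace_R_piece])

lemma homog_z_in_R_piece: "homog_z b q \<in> R_piece 0 (int b)"
  unfolding homog_z_def
proof (rule R_piece_sum)
  fix j assume "j \<in> {..b}"
  then show "Poly_Mapping.single (bimon 0 b 0 j) (coeff q j) \<in> R_piece 0 (int b)"
    using single_bimon_in_R_piece[of "bimon 0 b 0 j" 0 b] by (simp add: bimons_iff)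
qed

lemma dehom_zx_homog_z:
  assumes "degree q \<le> b"
  shows "dehom_zx (homog_z b q) = [:q:]"
proof -
  have "dehom_zx (homog_z b q) = (\<Sum>j\<le>b. [:monom (coeff q j) j:])"
    unfolding dehom_zx_def homog_z_def const2.ev_sum const2.ev_single
    by (simp add: poly_const_pow smult_monom flip: monom_altdef)
  also have "\<dots> = [:\<Sum>j\<le>b. monom (coeff q j) j:]"
    by (induction b) simp_all
  finally show ?thesis using poly_as_sum_of_monoms'[OF assms] by simp
qed

context three_forms
begin

text \<open>The coefficients of \<open>x^i y^(2-i)\<close> in the three forms at the point
  \<open>(z : w)\<close>; \<open>poly_row\<close> is the same with \<open>z\<close> a polynomial
  variable and \<open>w = 1\<close>.\<close>

definition row :: "'k \<Rightarrow> 'k \<Rightarrow> nat \<Rightarrow> 'k \<times> 'k \<times> 'k" where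
  "row z w i = (z * hcoeff 2 1 p0 i 1 + w * hcoeff 2 1 p0 i 0, z * hcoeff 2 1 p1 i 1 + w * hcoeff 2 1 p1 i 0,
     z * hcoeff 2 1 p2 i 1 + w * hcoeff 2 1 p2 i 0)"

definition poly_row :: "nat \<Rightarrow> 'k poly \<times> 'k poly \<times> 'k poly" where
  "poly_row i = (xcoeff p0 i, xcoeff p1 i, xcoeff p2 i)"

definition \<Delta> :: "'k poly" where
  "\<Delta> = det3 (poly_row 0) (poly_row 1) (poly_row 2)"

text \<open>At rank at most 1 the three quadratics obtained by fixing \<open>(z : w)\<close> are
  proportional, so they share a root \<open>(x : y)\<close>, giving a common zero.\<close>

lemma rank_row:
  assumes zw: "(z, w) \<noteq> (0, 0)"
  shows "cross3 (row z w 0) (row z w 1) \<noteq> 0 \<or> cross3 (row z w 0) (row z w 2) \<noteq> 0 \<or>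
    cross3 (row z w 1) (row z w 2) \<noteq> 0"
proof (rule ccontr)
  assume contra: "\<not> ?thesis"
  define r where "r p i = z * hcoeff 2 1 p i 1 + w * hcoeff 2 1 p i 0" for p :: "'k mpoly4" and i
  have row_r: "row z w i = (r p0 i, r p1 i, r p2 i)" for i by (simp add: row_def r_def)
  obtain x y where xy: "(x, y) \<noteq> (0, 0)" "r p0 2 * x^2 + r p0 1 * x * y + r p0 0 * y^2 = 0"
    "r p1 2 * x^2 + r p1 1 * x * y + r p1 0 * y^2 = 0" "r p2 2 * x^2 + r p2 1 * x * y + r p2 0 * y^2 = 0"
    by (rule proportional_quadratics_root[of "r p0 2" "r p1 1" "r p1 2" "r p0 1" "r p1 0" "r p0 0"
        "r p2 1" "r p2 2" "r p2 0"])
      (use contra in \<open>simp_all add: row_r zero_prod_def mult.commute\<close>)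
  have "eval4 p x y z w = r p 2 * x^2 + r p 1 * x * y + r p 0 * y^2" if "p \<in> R_piece 2 1" for p
    using that unfolding eval4_eq_ev const0.ev_21[OF that] r_def by (simp add: algebra_simps)
  then show False using no_common_zero[OF xy(1) zw] xy p0 p1 p2 by simp
qed

lemma poly_xcoeff:
  assumes "p \<in> R_piece 2 1" "i \<in> {0, 1, 2}"
  shows "poly (xcoeff p i) t = t * hcoeff 2 1 p i 1 + hcoeff 2 1 p i 0"
  using assms(2) xcoeff_21(1)[OF assms(1)] xcoeff_21(2)[OF assms(1)] xcoeff_21(3)[OF assms(1)] by auto

lemma poly_\<Delta>: "poly \<Delta> t = det3 (row t 1 0) (row t 1 1) (row t 1 2)"
  by (simp add: \<Delta>_def det3_def poly_row_def row_def poly_xcoeff[OF p0] poly_xcoeff[OF p1] poly_xcoeff[OF p2]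
    poly_xcoeff[OF p0, of 1, unfolded One_nat_def] poly_xcoeff[OF p1, of 1, unfolded One_nat_def] 
    poly_xcoeff[OF p2, of 1, unfolded One_nat_def])

text \<open>Vanishing polynomial cross products would vanish after evaluation at 0, against
  \<open>rank_row\<close> at the point \<open>(0 : 1)\<close>.\<close>

lemma rank_poly_row:
  "cross3 (poly_row 0) (poly_row 1) \<noteq> 0 \<or> cross3 (poly_row 0) (poly_row 2) \<noteq> 0 \<or>
    cross3 (poly_row 1) (poly_row 2) \<noteq> 0"
proof -
  have *: "cross3 (row 0 1 i) (row 0 1 j) = 0" if "cross3 (poly_row i) (poly_row j) = 0"
    "i \<in> {0, 1, 2}" "j \<in> {0, 1, 2}" for i j
  proof -
    have eqs: "xcoeff p1 i * xcoeff p2 j = xcoeff p2 i * xcoeff p1 j"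
      "xcoeff p2 i * xcoeff p0 j = xcoeff p0 i * xcoeff p2 j"
      "xcoeff p0 i * xcoeff p1 j = xcoeff p1 i * xcoeff p0 j"
      using that(1) by (simp_all add: poly_row_def zero_prod_def)
    show ?thesis
      using eqs[THEN arg_cong[where f = "\<lambda>f. poly f 0"]]
      unfolding poly_mult poly_xcoeff[OF p0 that(2)] poly_xcoeff[OF p1 that(2)] poly_xcoeff[OF p2 that(2)]
        poly_xcoeff[OF p0 that(3)] poly_xcoeff[OF p1 that(3)] poly_xcoeff[OF p2 that(3)]
      by (simp add: row_def zero_prod_def)
  qed
  show ?thesis using rank_row[of 0 1] *[of 0 1] *[of 0 2] *[of 1 2] by auto
qed

lemma dehom_zx_comb:
  assumes "dehom_zx A0 = [:a0:]" "dehom_zx A1 = [:a1:]" "dehom_zx A2 = [:a2:]"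
  shows "dehom_zx (A0 * p0 + A1 * p1 + A2 * p2) =
    [:dot3 (a0, a1, a2) (poly_row 0), dot3 (a0, a1, a2) (poly_row 1), dot3 (a0, a1, a2) (poly_row 2):]"
proof -
  have "dehom_zx (A0 * p0 + A1 * p1 + A2 * p2) =
    [:a0:] * [:xcoeff p0 0, xcoeff p0 1, xcoeff p0 2:] + [:a1:] * [:xcoeff p1 0, xcoeff p1 1, xcoeff p1 2:] +
       [:a2:] * [:xcoeff p2 0, xcoeff p2 1, xcoeff p2 2:]"
    unfolding dehom_zx_hom assms xcoeff_21(4)[OF p0, symmetric] xcoeff_21(4)[OF p1, symmetric]
      xcoeff_21(4)[OF p2, symmetric] ..
  then show ?thesis by (simp add: poly_row_def)
qed

lemma z_syzygy_iff:
  assumes A: "A0 \<in> R_piece 0 (int b)" "A1 \<in> R_piece 0 (int b)" "A2 \<in> R_piece 0 (int b)"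
    and a: "dehom_zx A0 = [:a0:]" "dehom_zx A1 = [:a1:]" "dehom_zx A2 = [:a2:]"
  shows "A0 * p0 + A1 * p1 + A2 * p2 = 0 \<longleftrightarrow>
    dot3 (a0, a1, a2) (poly_row 0) = 0 \<and> dot3 (a0, a1, a2) (poly_row 1) = 0 \<and> dot3 (a0, a1, a2) (poly_row 2) = 0"
proof -
  have "A * p \<in> R_piece (int 2) (int (b + 1))" if "A \<in> R_piece 0 (int b)" "p \<in> R_piece 2 1" for A p :: "'k mpoly4"
    using R_piece_mult[OF that] by (simp add: add.commute)
  then have "A0 * p0 + A1 * p1 + A2 * p2 \<in> R_piece (int 2) (int (b + 1))"
    using A p0 p1 p2 by (intro R.subspace_add[OF subspace_R_piece])
  then have "A0 * p0 + A1 * p1 + A2 * p2 = 0 \<longleftrightarrow> dehom_zx (A0 * p0 + A1 * p1 + A2 * p2) = 0"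
    using dehom_zx_eq_0_iff by blast
  then show ?thesis
    using dehom_zx_comb[of A0 a0 A1 a1 A2 a2] a by simp
qed

text \<open>Homogenised, the triple has bidegree (0,1); multiplication by \<open>x\<close> moves it
  to (1,1), where \<open>syzygy_11_zero\<close> applies.\<close>

lemma poly_syzygy_degree_1:
  assumes deg: "degree a0 \<le> 1" "degree a1 \<le> 1" "degree a2 \<le> 1"
    and syz: "dot3 (a0, a1, a2) (poly_row 0) = 0" "dot3 (a0, a1, a2) (poly_row 1) = 0"
      "dot3 (a0, a1, a2) (poly_row 2) = 0"
  shows "a0 = 0 \<and> a1 = 0 \<and> a2 = 0"
proof -
  have "homog_z 1 a0 * p0 + homog_z 1 a1 * p1 + homog_z 1 a2 * p2 = 0"
    using z_syzygy_iff[OF homog_z_in_R_piece homog_z_in_R_piece homog_z_in_R_piece dehom_zx_homog_z[OF deg(1)]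
        dehom_zx_homog_z[OF deg(2)] dehom_zx_homog_z[OF deg(3)]] syz by blast
  define x where "x = Poly_Mapping.single (bimon 1 0 1 0) (1::'k)"
  have x: "x \<in> R_piece 1 0" "dehom_zx x = [:0, 1:]"
    using single_bimon_in_R_piece[of "bimon 1 0 1 0" 1 0 "1::'k"]
    by (simp_all add: x_def bimons_iff dehom_zx_def const2.ev_single flip: one_pCons)
  have "x * homog_z 1 a0 * p0 + x * homog_z 1 a1 * p1 + x * homog_z 1 a2 * p2 = 0"
    using arg_cong[OF \<open>homog_z 1 a0 * p0 + homog_z 1 a1 * p1 + homog_z 1 a2 * p2 = 0\<close>, of "(*) x"]
    by (simp add: algebra_simps)
  moreover have "x * homog_z 1 a \<in> R_piece 1 1" for a
    using R_piece_mult[OF x(1) homog_z_in_R_piece[of 1 a]] by simp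
  ultimately have "x * homog_z 1 a0 = 0 \<and> x * homog_z 1 a1 = 0 \<and> x * homog_z 1 a2 = 0"
    by (intro syzygy_11_zero)
  moreover have "a = 0" if "x * homog_z 1 a = 0" "degree a \<le> 1" for a
    using arg_cong[OF that(1), of dehom_zx] that(2) by (simp add: dehom_zx_hom x dehom_zx_homog_z)
  ultimately show ?thesis using deg by blast
qed

lemma degree_poly_row_cross:
  assumes "(h0, h1, h2) = cross3 (poly_row i) (poly_row j)"
  shows "degree h0 \<le> 2 \<and> degree h1 \<le> 2 \<and> degree h2 \<le> 2"
proof -
  have deg: "degree (a * b - c * d) \<le> 2"
    if "degree a \<le> 1" "degree b \<le> 1" "degree c \<le> 1" "degree d \<le> 1" for a b c d :: "'k poly"
    using degree_mult_le[of a b] degree_mult_le[of c d] that by (intro degree_diff_le) simp_all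
  have "degree (xcoeff p i) \<le> 1" if "p \<in> R_piece 2 1" for p :: "'k mpoly4" and i
    using degree_dehom_zx(2)[of p 2 1 i] that by simp
  then show ?thesis using assms p0 p1 p2 by (auto simp: poly_row_def intro!: deg)
qed

text \<open>A nonzero cross product of two rows has degree at most 2. A common root could be divided
  out, and a common zero at infinity lowers the degree; either would leave a nonzero solution of
  degree at most 1, against \<open>poly_syzygy_degree_1\<close>.\<close>

lemma degenerate_generator:
  assumes "\<Delta> = 0"
  obtains h0 h1 h2 where "base_point_free 2 h0 h1 h2" "dot3 (h0, h1, h2) (poly_row 0) = 0"
    "dot3 (h0, h1, h2) (poly_row 1) = 0" "dot3 (h0, h1, h2) (poly_row 2) = 0"
    "\<And>A. dot3 A (poly_row 0) = 0 \<Longrightarrow> dot3 A (poly_row 1) = 0 \<Longrightarrow> dot3 A (poly_row 2) = 0 \<Longrightarrow>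
      cross3 A (h0, h1, h2) = 0"
proof -
  obtain H where H: "H \<noteq> 0" "H \<in> {cross3 (poly_row 0) (poly_row 1), cross3 (poly_row 0) (poly_row 2),
      cross3 (poly_row 1) (poly_row 2)}"
    "dot3 H (poly_row 0) = 0" "dot3 H (poly_row 1) = 0" "dot3 H (poly_row 2) = 0"
    "\<And>A. dot3 A (poly_row 0) = 0 \<Longrightarrow> dot3 A (poly_row 1) = 0 \<Longrightarrow> dot3 A (poly_row 2) = 0 \<Longrightarrow> cross3 A H = 0"
    using det3_eq_0_solution[OF assms[unfolded \<Delta>_def] rank_poly_row] by blast
  obtain h0 h1 h2 where h: "H = (h0, h1, h2)" by (cases H)
  have deg: "degree h0 \<le> 2 \<and> degree h1 \<le> 2 \<and> degree h2 \<le> 2"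
    using H(2) unfolding h by (elim insertE emptyE) (rule degree_poly_row_cross, assumption)+
  have "base_point_free 2 h0 h1 h2"
    unfolding base_point_free_def
  proof (intro conjI notI allI)
    fix x assume "poly h0 x = 0 \<and> poly h1 x = 0 \<and> poly h2 x = 0"
    then obtain k0 k1 k2 where k: "h0 = [:- x, 1:] * k0" "h1 = [:- x, 1:] * k1" "h2 = [:- x, 1:] * k2"
      by (auto simp: poly_eq_0_iff_dvd elim!: dvdE)
    have degk: "degree k \<le> 1" if "degree ([:- x, 1:] * k) \<le> 2" for k
      using that degree_mult_eq[of "[:- x, 1:]" k] by (cases "k = 0") auto
    have dotk: "dot3 (h0, h1, h2) u = [:- x, 1:] * dot3 (k0, k1, k2) u" for u
      by (cases u) (simp add: k algebra_simps)
    have dotk0: "dot3 (k0, k1, k2) u = 0" if "dot3 H u = 0" for u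
    proof -
      have "[:- x, 1:] * dot3 (k0, k1, k2) u = 0" using that unfolding h dotk .
      then show ?thesis by (metis mult_eq_0_iff pCons_eq_0_iff zero_neq_one)
    qed
    have "degree k0 \<le> 1" "degree k1 \<le> 1" "degree k2 \<le> 1"
      using deg unfolding k by (blast intro: degk)+
    from poly_syzygy_degree_1[OF this H(3-5)[THEN dotk0]] have "k0 = 0 \<and> k1 = 0 \<and> k2 = 0" .
    then show False using H(1) by (simp add: h k zero_prod_def)
  next
    assume *: "coeff h0 2 = 0 \<and> coeff h1 2 = 0 \<and> coeff h2 2 = 0"
    have "degree k \<le> 1" if "degree k \<le> 2" "coeff k 2 = 0" for k :: "'k poly"
    proof (rule degree_le, intro allI impI)
      fix i :: nat assume "i > 1"
      then consider "i = 2" | "i > 2" by linarith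
      then show "coeff k i = 0" using that by cases (auto intro: coeff_eq_0)
    qed
    then have "degree h0 \<le> 1" "degree h1 \<le> 1" "degree h2 \<le> 1" using deg * by simp_all
    then have "h0 = 0 \<and> h1 = 0 \<and> h2 = 0"
      using H(3-5) unfolding h by (rule poly_syzygy_degree_1)
    then show False using H(1) by (simp add: h zero_prod_def)
  qed (use deg in auto)
  then show thesis using that H(3-6) unfolding h by blast
qed

lemma z_piece_dehom:
  assumes "A \<in> R_piece 0 (int b)"
  obtains a where "dehom_zx A = [:a:]" "degree a \<le> b"
proof -
  have A: "A \<in> R_piece (int 0) (int b)" using assms by simp
  obtain a where "dehom_zx A = [:a:]" using poly_eq_pCons1[OF degree_dehom_zx(1)[OF A]] by blast
  then show thesis using that degree_dehom_zx(2)[OF A, of 0] by simp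
qed

lemma free_piece_2:
  "(A0, A1, A2) \<in> free_piece 2 (int b + 1) \<longleftrightarrow>
    A0 \<in> R_piece 0 (int b) \<and> A1 \<in> R_piece 0 (int b) \<and> A2 \<in> R_piece 0 (int b)"
  by (simp add: free_piece_def)

lemma dehom_zx_eq_0_z_iff: "A \<in> R_piece 0 (int b) \<Longrightarrow> dehom_zx A = 0 \<longleftrightarrow> A = 0"
  using dehom_zx_eq_0_iff[of A 0 b] by simp

lemma hilbert_function_2_nondegenerate:
  assumes "\<Delta> \<noteq> 0"
  shows "hilbert_function (Syz p0 p1 p2) 2 (int b + 1) = 0"
proof (rule hilbert_function_zero)
  fix F assume F: "F \<in> free_piece 2 (int b + 1)" "comb F = 0"
  obtain A0 A1 A2 where A: "F = (A0, A1, A2)" by (cases F)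
  have R: "A0 \<in> R_piece 0 (int b)" "A1 \<in> R_piece 0 (int b)" "A2 \<in> R_piece 0 (int b)"
    using F(1) by (simp_all add: A free_piece_2)
  obtain a0 where a0: "dehom_zx A0 = [:a0:]" "degree a0 \<le> b"
    using z_piece_dehom[OF R(1)] by blast
  obtain a1 where a1: "dehom_zx A1 = [:a1:]" "degree a1 \<le> b"
    using z_piece_dehom[OF R(2)] by blast
  obtain a2 where a2: "dehom_zx A2 = [:a2:]" "degree a2 \<le> b"
    using z_piece_dehom[OF R(3)] by blast
  note a = a0(1) a1(1) a2(1) and deg = a0(2) a1(2) a2(2)
  have "dot3 (a0, a1, a2) (poly_row 0) = 0" "dot3 (a0, a1, a2) (poly_row 1) = 0" "dot3 (a0, a1, a2) (poly_row 2) = 0"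
    using z_syzygy_iff[OF R a] F(2) by (auto simp: A comb_simp)
  then have "(a0, a1, a2) = 0" using det3_eq_0 assms unfolding \<Delta>_def by blast
  then show "F = 0" using R a by (simp add: A zero_prod_def dehom_zx_eq_0_z_iff[symmetric])
qed

text \<open>The syzygies are the multiples of the quadratic generator \<open>h\<close> by forms of
  degree \<open>b - 2\<close> in \<open>z, w\<close>, a space of dimension
  \<open>b - 1\<close>.\<close>

lemma hilbert_function_2_degenerate:
  assumes "\<Delta> = 0"
  shows "hilbert_function (Syz p0 p1 p2) 2 (int b + 1) = b - 1"
proof (cases "b \<le> 1")
  \<comment> \<open>Here the truncated \<open>b - 1\<close> is 0, and there are no nonzero solutions
    of degree at most 1.\<close>
  case True
  have "hilbert_function (Syz p0 p1 p2) 2 (int b + 1) = 0"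
  proof (rule hilbert_function_zero)
    fix F assume F: "F \<in> free_piece 2 (int b + 1)" "comb F = 0"
    obtain A0 A1 A2 where A: "F = (A0, A1, A2)" by (cases F)
    have R: "A0 \<in> R_piece 0 (int b)" "A1 \<in> R_piece 0 (int b)" "A2 \<in> R_piece 0 (int b)"
      using F(1) by (simp_all add: A free_piece_2)
    obtain a0 where a0: "dehom_zx A0 = [:a0:]" "degree a0 \<le> b"
      using z_piece_dehom[OF R(1)] by blast
    obtain a1 where a1: "dehom_zx A1 = [:a1:]" "degree a1 \<le> b"
      using z_piece_dehom[OF R(2)] by blast
    obtain a2 where a2: "dehom_zx A2 = [:a2:]" "degree a2 \<le> b"
      using z_piece_dehom[OF R(3)] by blast
    note a = a0(1) a1(1) a2(1) and deg = a0(2) a1(2) a2(2)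
    have "a0 = 0 \<and> a1 = 0 \<and> a2 = 0"
      using z_syzygy_iff[OF R a] F(2) deg True by (intro poly_syzygy_degree_1) (auto simp: A comb_simp)
    then show "F = 0" using R a by (simp add: A zero_prod_def dehom_zx_eq_0_z_iff[symmetric])
  qed
  then show ?thesis using True by simp
next
  case False
  obtain h0 h1 h2 where h: "base_point_free 2 h0 h1 h2" "dot3 (h0, h1, h2) (poly_row 0) = 0"
    "dot3 (h0, h1, h2) (poly_row 1) = 0" "dot3 (h0, h1, h2) (poly_row 2) = 0"
    "\<And>A. dot3 A (poly_row 0) = 0 \<Longrightarrow> dot3 A (poly_row 1) = 0 \<Longrightarrow> dot3 A (poly_row 2) = 0 \<Longrightarrow>
      cross3 A (h0, h1, h2) = 0"
    using degenerate_generator[OF assms] by blast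
  have degh: "degree h0 \<le> 2" "degree h1 \<le> 2" "degree h2 \<le> 2"
    using h(1) unfolding base_point_free_def by simp_all
  define \<psi> where "\<psi> q = (q * homog_z 2 h0, q * homog_z 2 h1, q * homog_z 2 h2)" for q
  have lin: "Vector_Spaces.linear scale4 scale_triple \<psi>"
    by unfold_locales (auto simp: \<psi>_def scale4_def algebra_simps)
  have dehom_mult: "dehom_zx (q * homog_z 2 h) = [:r * h:]" if "dehom_zx q = [:r:]" "degree h \<le> 2" for q r h
    by (simp add: dehom_zx_hom that dehom_zx_homog_z mult.commute)
  have mult_R: "q * homog_z 2 h \<in> R_piece 0 (int b)" if "q \<in> R_piece 0 (int (b - 2))" for q h
    using R_piece_mult[OF that homog_z_in_R_piece[of 2 h]] False by (simp add: of_nat_diff)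
  let ?V = "R_piece 0 (int (b - 2)) :: 'k mpoly4 set"
  have H0: "homog_z 2 h0 * p0 + homog_z 2 h1 * p1 + homog_z 2 h2 * p2 = 0"
    using z_syzygy_iff[OF homog_z_in_R_piece homog_z_in_R_piece homog_z_in_R_piece dehom_zx_homog_z[OF degh(1)]
        dehom_zx_homog_z[OF degh(2)] dehom_zx_homog_z[OF degh(3)]] h by blast
  have comb_\<psi>: "comb (\<psi> q) = 0" for q
  proof -
    have "comb (\<psi> q) = q * (homog_z 2 h0 * p0 + homog_z 2 h1 * p1 + homog_z 2 h2 * p2)"
      by (simp add: \<psi>_def comb_simp algebra_simps)
    then show ?thesis by (simp add: H0)
  qed
  have "\<psi> ` ?V = {F \<in> free_piece 2 (int b + 1). comb F = 0}"
  proof (intro equalityI subsetI)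
    fix F assume "F \<in> \<psi> ` ?V"
    then show "F \<in> {F \<in> free_piece 2 (int b + 1). comb F = 0}"
      using comb_\<psi> mult_R by (auto simp: \<psi>_def free_piece_2)
  next
    fix F assume F: "F \<in> {F \<in> free_piece 2 (int b + 1). comb F = 0}"
    obtain A0 A1 A2 where A: "F = (A0, A1, A2)" by (cases F)
    have R: "A0 \<in> R_piece 0 (int b)" "A1 \<in> R_piece 0 (int b)" "A2 \<in> R_piece 0 (int b)"
      using F by (simp_all add: A free_piece_2)
    obtain a0 where a0: "dehom_zx A0 = [:a0:]" "degree a0 \<le> b"
      using z_piece_dehom[OF R(1)] by blast
    obtain a1 where a1: "dehom_zx A1 = [:a1:]" "degree a1 \<le> b"
      using z_piece_dehom[OF R(2)] by blast
    obtain a2 where a2: "dehom_zx A2 = [:a2:]" "degree a2 \<le> b"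
      using z_piece_dehom[OF R(3)] by blast
    note a = a0(1) a1(1) a2(1) and deg = a0(2) a1(2) a2(2)
    have "cross3 (a0, a1, a2) (h0, h1, h2) = 0"
      using z_syzygy_iff[OF R a] F by (intro h(5)) (auto simp: A comb_simp)
    then have "a0 * h1 = a1 * h0" "a0 * h2 = a2 * h0" "a1 * h2 = a2 * h1"
      by (simp_all add: zero_prod_def)
    from base_point_free_multiple[OF h(1) this] obtain q where q: "a0 = q * h0" "a1 = q * h1" "a2 = q * h2" .
    \<comment> \<open>Since \<open>h\<close> is base point free of degree 2, the multiplier
      \<open>q\<close> loses exactly the 2 degrees needed to homogenise it in degree
      \<open>b - 2\<close>.\<close>
    have degq: "degree q \<le> b - 2"
      using base_point_free_degree[OF h(1), of q b] deg unfolding q by (cases "q = 0") auto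
    have "homog_z (b - 2) q * homog_z 2 h = A"
      if "A \<in> R_piece 0 (int b)" "dehom_zx A = [:q * h:]" "degree h \<le> 2" for A h
      by (rule dehom_zx_inject[of _ 0 b])
         (use that mult_R[OF homog_z_in_R_piece] dehom_mult[OF dehom_zx_homog_z[OF degq]] in simp_all)
    then have "\<psi> (homog_z (b - 2) q) = F"
      using R a degh by (simp add: \<psi>_def A q)
    then show "F \<in> \<psi> ` ?V" using homog_z_in_R_piece by blast
  qed
  moreover have "R3.dim (\<psi> ` ?V) = b - 1"
  proof -
    interpret PR: vector_space_pair scale4 scale_triple by unfold_locales
    have "q = 0" if \<psi>q: "\<psi> q = 0" "q \<in> ?V" for q
    proof -
      obtain r where r: "dehom_zx q = [:r:]" using z_piece_dehom[OF \<psi>q(2)] by blast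
      have "dehom_zx (q * homog_z 2 h0) = 0" "dehom_zx (q * homog_z 2 h1) = 0" "dehom_zx (q * homog_z 2 h2) = 0"
        using \<psi>q(1) by (simp_all add: \<psi>_def zero_prod_def dehom_zx_hom)
      then have "r * h0 = 0" "r * h1 = 0" "r * h2 = 0" using dehom_mult[OF r] degh by simp_all
      then have "r = 0" using h(1) unfolding base_point_free_def by auto
      then show ?thesis using r dehom_zx_eq_0_z_iff[OF \<psi>q(2)] by simp
    qed
    moreover have \<psi>0: "\<psi> 0 = 0" by (simp add: \<psi>_def zero_prod_def)
    ultimately have "{q \<in> ?V. \<psi> q = 0} = {0}"
      using zero_in_R_piece \<psi>0 by blast
    moreover have "R.dim {0 :: 'k mpoly4} = 0" by (rule R.dim_zero_space)
    moreover have "?V \<subseteq> R.span ((\<lambda>t. Poly_Mapping.single t 1) ` bimons 0 (b - 2))"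
      using R_piece_span[of 0 "b - 2"] by simp
    moreover have "R.dim ?V = (0 + 1) * (b - 2 + 1)"
      using dim_R_piece[of 0 "b - 2"] by (simp only: of_nat_0)
    then have "R.dim ?V = b - 1" using False by simp
    ultimately show ?thesis
      using PR.dim_kernel_plus_image[OF lin subspace_R_piece[of 0 "int (b - 2)"],
          of "(\<lambda>t. Poly_Mapping.single t 1) ` bimons 0 (b - 2)"] by simp
  qed
  ultimately show ?thesis by (simp add: hilbert_function_eq)
qed

end

section \<open>The intersection with the Segre variety\<close>

text \<open>Over a finite field, 1 plus the product of all \<open>X - a\<close> would be nonconstant
  without a root.\<close>

lemma infinite_alg_closed: "infinite (UNIV :: 'k::alg_closed_field set)"
proof
  assume fin: "finite (UNIV :: 'k set)"
  define P where "P = (\<Prod>a\<in>(UNIV::'k set). [:- a, 1:])"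
  have "degree P = card (UNIV :: 'k set)"
    unfolding P_def by (subst degree_prod_sum_eq) auto
  then have "degree P > 0" using fin by (simp add: card_gt_0_iff)
  then have "degree (P + 1) > 0" by (simp add: degree_add_eq_left)
  then obtain x where "poly (P + 1) x = 0" using alg_closed_imp_poly_has_root by blast
  moreover have "poly P x = 0"
    unfolding P_def poly_prod using fin by (auto intro!: prod_zero bexI[of _ x])
  ultimately show False by simp
qed

lemma lookup_scale4: "Poly_Mapping.lookup (scale4 c f) t = c * Poly_Mapping.lookup f t"
  by (simp add: scale4_def map.rep_eq when_def flip: mult_map_scale_conv_mult)

lemma cross3_eq_0_parallel:
  fixes A H :: "'a::field \<times> 'a \<times> 'a"
  assumes "cross3 A H = 0" "H \<noteq> 0"
  obtains c where "A = (c * fst H, c * fst (snd H), c * snd (snd H))"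
proof -
  obtain A0 A1 A2 H0 H1 H2 where [simp]: "A = (A0, A1, A2)" "H = (H0, H1, H2)" by (metis prod_cases3)
  have eqs: "A1 * H2 = A2 * H1" "A2 * H0 = A0 * H2" "A0 * H1 = A1 * H0"
    using assms(1) by (simp_all add: zero_prod_def)
  consider "H0 \<noteq> 0" | "H1 \<noteq> 0" | "H2 \<noteq> 0" using assms(2) by (auto simp: zero_prod_def)
  then show thesis
  proof cases
    case 1 then show thesis using eqs by (intro that[of "A0 / H0"]) (simp add: field_simps)
  next
    case 2 then show thesis using eqs by (intro that[of "A1 / H1"]) (simp add: field_simps)
  next
    case 3 then show thesis using eqs by (intro that[of "A2 / H2"]) (simp add: field_simps)
  qed
qed

lemma span_scale4_nonzero: "c \<noteq> 0 \<Longrightarrow> R.span {scale4 c v} = R.span {v}"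
proof -
  assume "c \<noteq> 0"
  then have "v \<in> R.span {scale4 c v}"
    using R.span_scale[OF R.span_base[of "scale4 c v" "{scale4 c v}"], of "inverse c"] by simp
  moreover have "scale4 c v \<in> R.span {v}"
    by (rule R.span_scale) (simp add: R.span_base)
  ultimately show ?thesis by (simp add: R.span_eq)
qed

context three_forms
begin

definition lin :: "'k \<times> 'k \<times> 'k \<Rightarrow> 'k mpoly4" where
  "lin = (\<lambda>(a0, a1, a2). scale4 a0 p0 + scale4 a1 p1 + scale4 a2 p2)"

lemma lin_simp: "lin (a0, a1, a2) = scale4 a0 p0 + scale4 a1 p1 + scale4 a2 p2"
  by (simp add: lin_def)

lemma lin_scale: "lin (c * a0, c * a1, c * a2) = scale4 c (lin (a0, a1, a2))"
  by (simp add: lin_simp R.scale_right_distrib)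

lemma lin_in_R_piece: "lin \<alpha> \<in> R_piece 2 1"
  using p0 p1 p2 by (cases \<alpha>)
    (simp add: lin_simp R.subspace_add[OF subspace_R_piece] R.subspace_scale[OF subspace_R_piece])

text \<open>Linear independence of the three forms: a linear relation is a syzygy with constant
  entries, excluded by \<open>syzygy_x_zero\<close>.\<close>

lemma lin_eq_0:
  assumes "lin \<alpha> = 0"
  shows "\<alpha> = 0"
proof -
  obtain a0 a1 a2 where \<alpha>: "\<alpha> = (a0, a1, a2)" by (cases \<alpha>)
  have "Poly_Mapping.single 0 a \<in> R_piece (int 0) 0" for a :: 'k
    using single_bimon_in_R_piece[of 0 0 0 a] by (simp add: bimons_iff)
  then have "Poly_Mapping.single (0::monomial) a0 = 0 \<and> Poly_Mapping.single (0::monomial) a1 = 0 \<and>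
      Poly_Mapping.single (0::monomial) a2 = 0"
    using assms by (intro syzygy_x_zero[of _ 0]) (simp_all add: \<alpha> lin_simp scale4_def)
  then show ?thesis by (auto simp: \<alpha> zero_prod_def dest: arg_cong[where f = "\<lambda>f. Poly_Mapping.lookup f 0"])
qed

lemma span_p: "R.span {p0, p1, p2} = range lin"
proof -
  have "R.span {p0, p1, p2} = {x. \<exists>a b c. x - scale4 a p0 - scale4 b p1 - scale4 c p2 = 0}"
    by (auto simp: R.span_insert)
  also have "\<dots> = range lin"
    by (auto simp: lin_def image_iff algebra_simps; blast)
  finally show ?thesis .
qed

text \<open>The coefficients of the quadratic obtained from \<open>v\<close> by fixing
  \<open>(z : w)\<close>. They all vanish when \<open>v\<close> is divisible by the linear form with
  zero \<open>(z : w)\<close>.\<close>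

definition form_row :: "'k mpoly4 \<Rightarrow> 'k \<Rightarrow> 'k \<Rightarrow> nat \<Rightarrow> 'k" where
  "form_row v z w i = z * hcoeff 2 1 v i 1 + w * hcoeff 2 1 v i 0"

lemma form_row_lin: "form_row (lin \<alpha>) z w i = dot3 \<alpha> (row z w i)"
  by (cases \<alpha>) (simp add: form_row_def row_def lin_simp hcoeff_def lookup_add lookup_scale4 algebra_simps)

lemma form_row_scale: "form_row (scale4 c v) z w i = c * form_row v z w i"
  by (simp add: form_row_def hcoeff_def lookup_scale4 algebra_simps)

lemma form_row_product:
  assumes q: "q \<in> R_piece 2 0" and l: "l \<in> R_piece 0 1" "l \<noteq> 0"
  obtains z w where "(z, w) \<noteq> (0, 0)" "\<And>i. i \<in> {0, 1, 2} \<Longrightarrow> form_row (q * l) z w i = 0"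
proof -
  have l': "l \<in> R_piece (int 0) (int 1)" using l by simp
  have ql: "q * l \<in> R_piece 2 1" using R_piece_mult[OF q l(1)] by simp
  \<comment> \<open>The zero of the linear form \<open>l\<close>.\<close>
  define z w where "z = - hcoeff 0 1 l 0 0" and "w = hcoeff 0 1 l 0 1"
  have "(z, w) \<noteq> (0, 0)"
  proof
    assume "(z, w) = (0, 0)"
    then have "hcoeff 0 1 l 0 0 = 0" "hcoeff 0 1 l 0 1 = 0" by (simp_all add: z_def w_def)
    then have "hcoeff 0 1 l i j = hcoeff 0 1 0 i j" if "i \<le> 0" "j \<le> 1" for i j
      using that by (cases j) (auto simp: hcoeff_def)
    then show False using R_piece_eqI[OF l' zero_in_R_piece] l(2) by blast
  qed
  \<comment> \<open>Keeping \<open>x\<close> as a polynomial variable yields all three coefficients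
    from one identity.\<close>
  moreover have "ev (\<lambda>c. [:c:]) [:0, 1:] 1 [:z:] [:w:] (q * l) = 0"
    by (simp add: const1.ev_mult const1.ev_bihomogeneous[OF l'] z_def w_def algebra_simps)
  then have "[:form_row (q * l) z w 0, form_row (q * l) z w 1, form_row (q * l) z w 2:] = 0"
    unfolding const1.ev_21[OF ql] by (simp add: form_row_def algebra_simps power2_eq_square)
  then have "form_row (q * l) z w i = 0" if "i \<in> {0, 1, 2}" for i
    using that by auto
  ultimately show thesis by (rule that)
qed

text \<open>By \<open>rank_row\<close> the solutions at a fixed point form a space of dimension at
  most 1.\<close>

lemma rank_row_unique:
  assumes zw: "(z, w) \<noteq> (0, 0)" and "\<alpha> \<noteq> 0" "\<beta> \<noteq> 0"
    and "\<And>i. i \<in> {0, 1, 2} \<Longrightarrow> dot3 \<alpha> (row z w i) = 0" "\<And>i. i \<in> {0, 1, 2} \<Longrightarrow> dot3 \<beta> (row z w i) = 0"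
  shows "R.span {lin \<alpha>} = R.span {lin \<beta>}"
proof -
  have "det3 (row z w 0) (row z w 1) (row z w 2) = 0"
    using det3_eq_0[OF assms(2)] assms(4) by simp
  then obtain H where H: "H \<noteq> 0"
    "\<And>A. dot3 A (row z w 0) = 0 \<Longrightarrow> dot3 A (row z w 1) = 0 \<Longrightarrow> dot3 A (row z w 2) = 0 \<Longrightarrow> cross3 A H = 0"
    using det3_eq_0_solution[OF _ rank_row[OF zw]] by blast
  have *: "R.span {lin A} = R.span {lin H}"
    if "A \<noteq> 0" "\<And>i. i \<in> {0, 1, 2} \<Longrightarrow> dot3 A (row z w i) = 0" for A
  proof -
    have "cross3 A H = 0" using that(2) by (intro H(2)) simp_all
    then obtain c where c: "A = (c * fst H, c * fst (snd H), c * snd (snd H))"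
      using cross3_eq_0_parallel H(1) by blast
    then have "c \<noteq> 0" using that(1) by (auto simp: zero_prod_def)
    moreover have "lin A = scale4 c (lin H)" unfolding c lin_scale by simp
    ultimately show ?thesis using span_scale4_nonzero by simp
  qed
  show ?thesis using *[OF assms(2,4)] *[OF assms(3,5)] by simp
qed

text \<open>A product \<open>q * l\<close> in the plane gives a solution at the zero of
  \<open>l\<close>. Up to scaling this zero is \<open>(1,0)\<close> or \<open>(t,1)\<close> with
  \<open>t\<close> a root of \<open>\<Delta>\<close>, and each such point accounts for at most one
  line.\<close>

lemma segre_plane_finite:
  assumes "\<Delta> \<noteq> 0"
  shows "finite (W_plane p0 p1 p2 \<inter> segre_Y)"
proof -
  define G where "G = (\<lambda>(z, w). {R.span {lin \<alpha>} | \<alpha>. \<alpha> \<noteq> 0 \<and> (\<forall>i\<in>{0,1,2}. dot3 \<alpha> (row z w i) = 0)})"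
  \<comment> \<open>The point \<open>(1,0)\<close> is always included, because
    \<open>\<Delta>\<close> is dehomogenised at \<open>w = 1\<close> and its roots do not detect
    it.\<close>
  define S where "S = insert (1, 0 :: 'k) ((\<lambda>t. (t, 1)) ` {t. poly \<Delta> t = 0})"
  have "finite (G s)" if sS: "s \<in> S" for s
  proof -
    obtain z w where s: "s = (z, w)" "(z, w) \<noteq> (0, 0)" using sS by (cases s) (auto simp: S_def)
    have unique: "L = L'" if L: "L \<in> G s" "L' \<in> G s" for L L'
    proof -
      obtain \<alpha> \<beta> where "L = R.span {lin \<alpha>}" "L' = R.span {lin \<beta>}" "\<alpha> \<noteq> 0" "\<beta> \<noteq> 0"
        "\<forall>i\<in>{0,1,2}. dot3 \<alpha> (row z w i) = 0" "\<forall>i\<in>{0,1,2}. dot3 \<beta> (row z w i) = 0"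
        using L unfolding G_def s by blast
      then show ?thesis using rank_row_unique[OF s(2), of \<alpha> \<beta>] by blast
    qed
    show ?thesis
    proof (cases "G s = {}")
      case False
      then obtain L where "L \<in> G s" by blast
      then have "G s \<subseteq> {L}" using unique by blast
      then show ?thesis by (rule finite_subset) simp
    qed simp
  qed
  moreover have "finite S" unfolding S_def using poly_roots_finite[OF assms] by simp
  ultimately have "finite (\<Union> (G ` S))" by blast
  moreover have "W_plane p0 p1 p2 \<inter> segre_Y \<subseteq> \<Union> (G ` S)"
  proof
    fix L assume L: "L \<in> W_plane p0 p1 p2 \<inter> segre_Y"
    then obtain v where v: "L = R.span {v}" "v \<in> R.span {p0, p1, p2}" "v \<noteq> 0"
      unfolding W_plane_def projectivization_def by blast
    then obtain \<alpha> where \<alpha>: "v = lin \<alpha>" unfolding span_p by blast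
    have "\<alpha> \<noteq> 0" using v(3) \<alpha> by (auto simp: lin_simp zero_prod_def)
    obtain q l where ql: "L = R.span {q * l}" "q \<in> R_piece 2 0" "l \<in> R_piece 0 1" "l \<noteq> 0"
      using L unfolding segre_Y_def by blast
    have "v \<in> R.span {q * l}" using v(1) ql(1) R.span_base by blast
    then obtain c where c: "v = scale4 c (q * l)" unfolding R.span_singleton by blast
    obtain z w where zw: "(z, w) \<noteq> (0, 0)" "\<And>i. i \<in> {0, 1, 2} \<Longrightarrow> form_row (q * l) z w i = 0"
      using form_row_product[OF ql(2-4)] by blast
    have dot: "dot3 \<alpha> (row z w i) = 0" if "i \<in> {0, 1, 2}" for i
      using form_row_scale[of c "q * l" z w i] zw(2)[OF that] unfolding c[symmetric] \<alpha> form_row_lin by simp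
    have row_scale: "row (c * z) (c * w) i = (c * fst (row z w i), c * fst (snd (row z w i)), c * snd (snd (row z w i)))"
      for c z w i by (simp add: row_def algebra_simps)
    have dot_scale: "dot3 \<alpha> (row (c * z) (c * w) i) = c * dot3 \<alpha> (row z w i)" for c z w i
      by (cases \<alpha>; cases "row z w i") (simp add: row_scale algebra_simps)
    show "L \<in> \<Union> (G ` S)"
    proof (cases "w = 0")
      case True
      then have "dot3 \<alpha> (row 1 0 i) = 0" if "i \<in> {0, 1, 2}" for i
        using dot_scale[of "inverse z" z w i] dot[OF that] zw(1) by simp
      then have "L \<in> G (1, 0)" using v(1) \<alpha> \<open>\<alpha> \<noteq> 0\<close> unfolding G_def by blast
      then show ?thesis by (auto simp: S_def)
    next
      case False
      then have d: "dot3 \<alpha> (row (inverse w * z) 1 i) = 0" if "i \<in> {0, 1, 2}" for i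
        using dot_scale[of "inverse w" z w i] dot[OF that] by simp
      then have "poly \<Delta> (inverse w * z) = 0"
        unfolding poly_\<Delta> using det3_eq_0[OF \<open>\<alpha> \<noteq> 0\<close>] by simp
      moreover have "L \<in> G (inverse w * z, 1)" using v(1) \<alpha> \<open>\<alpha> \<noteq> 0\<close> d unfolding G_def by blast
      ultimately show ?thesis by (auto simp: S_def)
    qed
  qed
  ultimately show ?thesis by (rule finite_subset[rotated])
qed

lemma form_factors:
  assumes v: "v \<in> R_piece 2 1" "v \<noteq> 0" and row0: "\<And>i. i \<in> {0, 1, 2} \<Longrightarrow> form_row v t 1 i = 0"
  shows "\<exists>q l. v = q * l \<and> q \<in> R_piece 2 0 \<and> q \<noteq> 0 \<and> l \<in> R_piece 0 1 \<and> l \<noteq> 0"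
proof -
  \<comment> \<open>Vanishing at \<open>(t : 1)\<close> means \<open>g = - t f\<close> in
    \<open>v = z f + w g\<close>, so \<open>v = f (z - t w)\<close>; \<open>q\<close> is
    \<open>f\<close> and \<open>l\<close> is \<open>z - t w\<close>.\<close>
  define q where "q = (\<Sum>i\<le>2. Poly_Mapping.single (bimon 2 0 i 0) (hcoeff 2 1 v i 1))"
  define l where "l = Poly_Mapping.single (bimon 0 1 0 1) 1 + Poly_Mapping.single (bimon 0 1 0 0) (- t)"
  have q: "q \<in> R_piece 2 0"
    unfolding q_def
  proof (rule R_piece_sum)
    fix i assume "i \<in> {..2::nat}"
    then show "Poly_Mapping.single (bimon 2 0 i 0) (hcoeff 2 1 v i 1) \<in> R_piece 2 0"
      using single_bimon_in_R_piece[of "bimon 2 0 i 0" 2 0] by (simp add: bimons_iff)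
  qed
  have l: "l \<in> R_piece 0 1"
    unfolding l_def
    using single_bimon_in_R_piece[of "bimon 0 1 0 1" 0 1 "1::'k"] single_bimon_in_R_piece[of "bimon 0 1 0 0" 0 1 "- t"]
    by (intro R.subspace_add[OF subspace_R_piece]) (simp_all add: bimons_iff)
  have dq: "dehom_xz q = [:zcoeff v 1:]"
    unfolding q_def dehom_xz_def const2.ev_sum const2.ev_single
    by (simp add: zcoeff_21(2)[OF v(1), unfolded dehom_xz_def One_nat_def] numeral_2_eq_2)
  have dl: "dehom_xz l = [:[:- t:], 1:]"
    by (simp add: l_def dehom_xz_def const2.ev_add const2.ev_single one_pCons)
  have h0: "hcoeff 2 1 v i 0 = - t * hcoeff 2 1 v i 1" if "i \<in> {0, 1, 2}" for i
    using row0[OF that] by (simp add: form_row_def add_eq_0_iff)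
  have z0: "zcoeff v 0 = smult (- t) (zcoeff v 1)"
    unfolding zcoeff_21(1,2)[OF v(1)] using h0[of 0] h0[of 1] h0[of 2] by simp
  have "dehom_xz v = [:zcoeff v 0, zcoeff v 1:]" by (rule zcoeff_21(3)[OF v(1)])
  also have "\<dots> = dehom_xz (q * l)" unfolding dehom_xz_hom dq dl z0 by simp
  finally have "dehom_xz v = dehom_xz (q * l)" .
  then have "v = q * l"
    using dehom_xz_inject[of v 2 1 "q * l"] v(1) R_piece_mult[OF q l] by simp
  then show ?thesis using q l v(2) by (intro exI[of _ q] exI[of _ l]) auto
qed

text \<open>Each \<open>t\<close> in the infinite field \<open>k\<close> gives a solution at
  \<open>(t : 1)\<close>, hence a point of the intersection, and distinct \<open>t\<close> give
  distinct points.\<close>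

lemma segre_plane_infinite:
  assumes "\<Delta> = 0"
  shows "infinite (W_plane p0 p1 p2 \<inter> segre_Y)"
proof -
  have "\<exists>\<alpha>. \<alpha> \<noteq> 0 \<and> (\<forall>i\<in>{0,1,2}. dot3 \<alpha> (row t 1 i) = 0)" for t
  proof -
    have det: "det3 (row t 1 0) (row t 1 1) (row t 1 2) = 0"
      using poly_\<Delta>[of t] assms by simp
    have "(t, 1) \<noteq> (0, 0 :: 'k)" by simp
    then obtain H where "H \<noteq> 0" "dot3 H (row t 1 0) = 0" "dot3 H (row t 1 1) = 0" "dot3 H (row t 1 2) = 0"
      using det3_eq_0_solution[OF det rank_row] by blast
    then show ?thesis by blast
  qed
  then obtain \<alpha> where \<alpha>: "\<And>t. \<alpha> t \<noteq> 0" "\<And>t i. i \<in> {0,1,2} \<Longrightarrow> dot3 (\<alpha> t) (row t 1 i) = 0" by metis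
  define F where "F t = R.span {lin (\<alpha> t)}" for t
  have nz: "lin (\<alpha> t) \<noteq> 0" for t using lin_eq_0 \<alpha>(1) by blast
  have "F t \<in> W_plane p0 p1 p2 \<inter> segre_Y" for t
  proof
    show "F t \<in> W_plane p0 p1 p2"
      unfolding F_def W_plane_def projectivization_def using span_p nz by blast
    have "\<exists>q l. lin (\<alpha> t) = q * l \<and> q \<in> R_piece 2 0 \<and> q \<noteq> 0 \<and> l \<in> R_piece 0 1 \<and> l \<noteq> 0"
      by (rule form_factors[OF lin_in_R_piece nz]) (unfold form_row_lin, rule \<alpha>(2))
    then obtain q l where "lin (\<alpha> t) = q * l" "q \<in> R_piece 2 0" "q \<noteq> 0" "l \<in> R_piece 0 1" "l \<noteq> 0"
      by blast
    then show "F t \<in> segre_Y" unfolding F_def segre_Y_def by auto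
  qed
  moreover have "inj F"
  proof (rule injI, rule ccontr)
    fix s t assume st: "F s = F t" "s \<noteq> t"
    have "lin (\<alpha> s) \<in> R.span {lin (\<alpha> t)}" using st(1) R.span_base[of "lin (\<alpha> s)"] unfolding F_def by blast
    then obtain c where c: "lin (\<alpha> s) = scale4 c (lin (\<alpha> t))" unfolding R.span_singleton by blast
    let ?v = "lin (\<alpha> s)"
    \<comment> \<open>Each coefficient of \<open>x^i y^(2-i)\<close> is a linear form in
      \<open>z, w\<close> with two distinct zeros \<open>(s : 1)\<close> and \<open>(t : 1)\<close>,
      hence zero.\<close>
    have zero: "hcoeff 2 1 ?v i j = 0" if "i \<in> {0, 1, 2}" "j \<in> {0, 1}" for i j
    proof -
      have "form_row ?v s 1 i = 0" unfolding form_row_lin by (rule \<alpha>(2)[OF that(1)])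
      moreover have "form_row ?v t 1 i = 0"
        unfolding c form_row_scale unfolding form_row_lin using \<alpha>(2)[OF that(1)] by simp
      ultimately have h: "s * hcoeff 2 1 ?v i 1 + hcoeff 2 1 ?v i 0 = 0" "t * hcoeff 2 1 ?v i 1 + hcoeff 2 1 ?v i 0 = 0"
        by (simp_all add: form_row_def)
      then have "(s - t) * hcoeff 2 1 ?v i 1 = 0" by algebra
      then have "hcoeff 2 1 ?v i 1 = 0" using st(2) by simp
      then show ?thesis using h(1) that(2) by auto
    qed
    have "?v = 0"
    proof (rule R_piece_eqI[of _ 2 1])
      show "hcoeff 2 1 ?v i j = hcoeff 2 1 0 i j" if "i \<le> 2" "j \<le> 1" for i j
      proof -
        have "i \<in> {0, 1, 2}" "j \<in> {0, 1}" using that by auto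
        then show ?thesis using zero by (simp add: hcoeff_def)
      qed
    qed (use lin_in_R_piece[of "\<alpha> s"] zero_in_R_piece in simp_all)
    then show False using nz by blast
  qed
  then have "infinite (range F)" using infinite_alg_closed finite_imageD by blast
  ultimately show ?thesis using infinite_super[of "range F"] by blast
qed

lemma generic_case_iff: "generic_case p0 p1 p2 \<longleftrightarrow> \<Delta> \<noteq> 0"
  and nongeneric_case_iff: "nongeneric_case p0 p1 p2 \<longleftrightarrow> \<Delta> = 0"
  using segre_plane_finite segre_plane_infinite unfolding generic_case_def nongeneric_case_def by blast+

section \<open>Assembly of the Hilbert function from its ranges of bidegrees\<close>

lemma hilbert_function_Syz:
  "int (hilbert_function (Syz p0 p1 p2) m n) =
    (if m \<ge> 5 \<and> n \<ge> 2 then 3 * (m - 3) * (n - 1) - (m - 5) * (n - 2)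
     else if m \<ge> 6 \<and> n = 1 then m - 5
     else if m = 2 \<and> n \<ge> 3 \<and> \<Delta> = 0 then n - 2
     else if m = 3 \<and> n \<ge> 3 then 2 * (n - 2)
     else if m = 4 \<and> n \<ge> 2 then 3 * (n - 1) + n - 2
     else 0)"
proof (cases "m < 2 \<or> n < 1")
  case True
  then show ?thesis using hilbert_function_negative[OF True] by auto
next
  case False
  define a b where "a = nat (m - 2)" and "b = nat (n - 1)"
  have mn: "m = int a + 2" "n = int b + 1" using False by (simp_all add: a_def b_def)
  \<comment> \<open>The cases are \<open>m = 2\<close>; then \<open>m\<close> from 3 to 5 with
    \<open>n = 1\<close>; then the surjective range without the bidegree (5,1).\<close>
  consider "a = 0" | "a \<noteq> 0" "a \<le> 3" "b = 0" | "a \<ge> 1 \<and> b \<ge> 1 \<or> a \<ge> 3" "a > 3 \<or> b \<noteq> 0" by linarith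
  then show ?thesis
  proof cases
    case 1
    then show ?thesis
      using hilbert_function_2_nondegenerate[of b] hilbert_function_2_degenerate[of b]
      by (cases "\<Delta> = 0") (auto simp: mn)
  next
    case 2
    then show ?thesis using hilbert_function_x_zero[OF 2(2)] by (auto simp: mn)
  next
    case 3
    \<comment> \<open>This single expression equals
      \<open>3 * (m - 3) * (n - 1) - (m - 5) * (n - 2)\<close>, and the formulas for
      \<open>m = 3\<close>, \<open>m = 4\<close> and \<open>n = 1\<close> are its
      specialisations.\<close>
    have "int (hilbert_function (Syz p0 p1 p2) m n) = 3 * ((m - 1) * n) - (m + 1) * (n + 1)"
      using hilbert_function_surj_range[OF 3(1)] by (simp add: mn add.commute)
    moreover have "m = 3 \<or> m = 4 \<or> m \<ge> 5" "m \<ge> 6 \<or> n \<ge> 2" using 3 by (auto simp: mn)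
    ultimately show ?thesis using False by (auto simp: algebra_simps)
  qed
qed

end

theorem proposition5p1:
  fixes p0 p1 p2 :: "'k::alg_closed_field mpoly4"
  assumes "p0 \<in> R_piece 2 1" and "p1 \<in> R_piece 2 1" and "p2 \<in> R_piece 2 1"
    and "no_common_zeros p0 p1 p2"
  shows "(generic_case p0 p1 p2 \<longrightarrow>
      (\<forall>m n :: int. int (hilbert_function (Syz p0 p1 p2) m n) =
        (if m \<ge> 5 \<and> n \<ge> 2 then 3 * (m - 3) * (n - 1) - (m - 5) * (n - 2)
         else if m \<ge> 6 \<and> n = 1 then m - 5
         else if m = 3 \<and> n \<ge> 3 then 2 * (n - 2)
         else if m = 4 \<and> n \<ge> 2 then 3 * (n - 1) + n - 2
         else 0))) \<and>
    (nongeneric_case p0 p1 p2 \<longrightarrow>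
      (\<forall>m n :: int. int (hilbert_function (Syz p0 p1 p2) m n) =
        (if m \<ge> 5 \<and> n \<ge> 2 then 3 * (m - 3) * (n - 1) - (m - 5) * (n - 2)
         else if m \<ge> 6 \<and> n = 1 then m - 5
         else if (m = 2 \<or> m = 3) \<and> n \<ge> 3 then (m - 1) * (n - 2)
         else if m = 4 \<and> n \<ge> 2 then 3 * (n - 1) + n - 2
         else 0)))"
proof -
  interpret three_forms p0 p1 p2 by unfold_locales (fact assms)+
  show ?thesis
    \<comment> \<open>For \<open>m = 2\<close> and \<open>m = 3\<close> the factor
      \<open>m - 1\<close> merges the two separate branches of
      \<open>hilbert_function_Syz\<close>.\<close>
    unfolding generic_case_iff nongeneric_case_iff hilbert_function_Syz by auto
qed

end
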